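(* Let $\mathcal{H}$ be a separable Hilbert space, $K\in B(\mathcal{H})$ an operator with closed range, $W=\{(W_i,\omega_i)\}_{i\in I}$ a $K$-fusion frame for $\mathcal{H}$ and $V=\{(V_i,\upsilon_i)\}_{i\in I}$ a Bessel fusion sequence in $\mathcal{H}$. For each $i\in I$ let $\{g_{i,j}\}_{j\in J_i}$ be a local frame for $V_i$ with bounds $A_i$ and $B_i$ (so $0<\inf_{i}A_i\le\sup_{i}B_i<\infty$), and let $\{\widetilde{g}_{i,j}\}_{j\in J_i}$ be its canonical dual frame in $V_i$. Then $V$ is a $K$-dual of $W$ if and only if the sequence $G=\{\upsilon_ig_{i,j}\}_{i\in I,j\in J_i}$ is a $K$-dual of the sequence $F=\{\omega_i\pi_{R(K)}\pi_{W_i}(S_W^{-1})^*K\widetilde{g}_{i,j}\}_{i\in I,j\in J_i}$.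
   Context: $I$ and the $J_i$ are countable index sets; $R(T)$ is the range of $T$; $\pi_U$ is the orthogonal projection of $\mathcal{H}$ onto a closed subspace $U$. A family $\{(W_i,\omega_i)\}_{i\in I}$ of closed subspaces with weights $\omega_i>0$ is a Bessel fusion sequence if there is $B<\infty$ with $\sum_i\omega_i^2\|\pi_{W_i}f\|^2\le B\|f\|^2$ for all $f\in\mathcal{H}$, and a $K$-fusion frame if moreover there is $A>0$ with $A\|K^*f\|^2\le\sum_i\omega_i^2\|\pi_{W_i}f\|^2$ for all $f$. The frame operator is $S_Wf=\sum_i\omega_i^2\pi_{W_i}f$. When $K$ has closed range and $W$ is a $K$-fusion frame, $S_W(R(K))$ is closed and the restriction $S_W:R(K)\to S_W(R(K))$ is invertible with bounded inverse; $S_W^{-1}:S_W(R(K))\to R(K)$ denotes this inverse and $(S_W^{-1})^*:R(K)\to S_W(R(K))$ its adjoint. A Bessel fusion sequence $V=\{(V_i,\upsilon_i)\}_{i\in I}$ is a $K$-dual of the $K$-fusion frame $W$ if $Kf=\sum_{i\in I}\omega_i\upsilon_i\,\pi_{R(K)}\pi_{W_i}(S_W^{-1})^*K\pi_{V_i}f$ for all $f\in\mathcal{H}$. For sequences of vectors: a Bessel sequence $\{g_k\}_k\subseteq\mathcal{H}$ is a $K$-dual of $\{f_k\}_k\subseteq\mathcal{H}$ if $Kf=\sum_k\langle f,g_k\rangle f_k$ for all $f\in\mathcal{H}$. Local frames for a family $\{V_i\}$: for each $i$, $\{g_{i,j}\}_{j\in J_i}$ is a frame for $V_i$ with frame bounds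 $A_i,B_i$, where $0<\inf_iA_i\le\sup_iB_i<\infty$. The canonical dual frame of a frame $\{g_j\}$ of $V_i$ with frame operator $S$ on $V_i$ is $\{S^{-1}g_j\}$. *)

theory Defs
  imports "HOL-Analysis.Analysis"
begin

text \<open>
  The scalar field is abstracted by a class with the two instances \<^typ>\<open>real\<close> and
  \<^typ>\<open>complex\<close> (up to isometric isomorphism these are its only models, by the
  Gelfand--Mazur theorem), so that real and complex Hilbert spaces are treated uniformly.
\<close>

class rc_field = real_normed_field +
  fixes scalar_conj :: "'a \<Rightarrow> 'a"
  assumes scalar_conj_add: "scalar_conj (x + y) = scalar_conj x + scalar_conj y"
    and scalar_conj_mult: "scalar_conj (x * y) = scalar_conj x * scalar_conj y"
    and mult_scalar_conj: "x * scalar_conj x = (norm x)\<^sup>2 *\<^sub>R 1"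

instantiation real :: rc_field
begin
definition scalar_conj_real :: "real \<Rightarrow> real" where "scalar_conj_real x = x"
instance by standard (auto simp: scalar_conj_real_def power2_eq_square)
end

instantiation complex :: rc_field
begin
definition scalar_conj_complex :: "complex \<Rightarrow> complex" where "scalar_conj_complex = cnj"
instance by standard
  (simp_all add: scalar_conj_complex_def scaleR_conv_of_real del: of_real_power flip: complex_norm_square)
end

text \<open>
  The inner product is linear in its first and conjugate-linear in its second argument.
  Addition, norm, topology and completeness come from the type class \<^class>\<open>banach\<close>;
  \<open>ip_self\<close> makes the norm the one induced by the inner product.
\<close>

locale hilbert_space = vector_space smul
  for smul :: "'k::rc_field \<Rightarrow> 'a::banach \<Rightarrow> 'a" +
  fixes ip :: "'a \<Rightarrow> 'a \<Rightarrow> 'k"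
  assumes scale_of_real: "smul (of_real r) x = r *\<^sub>R x"
    and ip_add_left: "ip (x + y) z = ip x z + ip y z"
    and ip_scale_left: "ip (smul c x) y = c * ip x y"
    and ip_conj_sym: "ip y x = scalar_conj (ip x y)"
    and ip_self: "ip x x = of_real ((norm x)\<^sup>2)"

lemma hilbert_space_real_inner:
  "hilbert_space scaleR (inner :: 'a::{real_inner,banach} \<Rightarrow> 'a \<Rightarrow> real)"
  by unfold_locales
     (auto simp: algebra_simps scalar_conj_real_def inner_commute power2_norm_eq_inner)

lemma hilbert_space_complex:
  "hilbert_space (*) (\<lambda>x y :: complex. x * cnj y)"
  by unfold_locales
     (simp_all add: algebra_simps scalar_conj_complex_def scaleR_conv_of_real
        del: of_real_power flip: complex_norm_square)

definition closed_subspace :: "('k::rc_field \<Rightarrow> 'a::banach \<Rightarrow> 'a) \<Rightarrow> 'a set \<Rightarrow> bool" where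
  "closed_subspace smul U \<longleftrightarrow> module.subspace smul U \<and> closed U"

definition bounded_operator :: "('k::rc_field \<Rightarrow> 'a::banach \<Rightarrow> 'a) \<Rightarrow> ('a \<Rightarrow> 'a) \<Rightarrow> bool" where
  "bounded_operator smul T \<longleftrightarrow> Vector_Spaces.linear smul smul T \<and> bounded_linear T"

definition orth_proj :: "('a::banach \<Rightarrow> 'a \<Rightarrow> 'k::rc_field) \<Rightarrow> 'a set \<Rightarrow> 'a \<Rightarrow> 'a" where
  "orth_proj ip U x = (THE u. u \<in> U \<and> (\<forall>y\<in>U. ip (x - u) y = 0))"

text \<open>
  The adjoint \<open>V \<rightarrow> U\<close> of an operator \<open>T : U \<rightarrow> V\<close> between closed subspaces; only its
  values on \<open>V\<close> are meaningful, and \<open>V\<close> itself is not needed to determine them.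
\<close>

definition adjoint_on ::
    "('a::banach \<Rightarrow> 'a \<Rightarrow> 'k::rc_field) \<Rightarrow> 'a set \<Rightarrow> ('a \<Rightarrow> 'a) \<Rightarrow> 'a \<Rightarrow> 'a" where
  "adjoint_on ip U T y = (THE u. u \<in> U \<and> (\<forall>x\<in>U. ip (T x) y = ip x u))"

text \<open>
  All series are unordered (unconditionally convergent) sums over the index set.
\<close>

definition bessel_fusion ::
    "('k::rc_field \<Rightarrow> 'a::banach \<Rightarrow> 'a) \<Rightarrow> ('a \<Rightarrow> 'a \<Rightarrow> 'k)
      \<Rightarrow> 'i set \<Rightarrow> ('i \<Rightarrow> 'a set) \<Rightarrow> ('i \<Rightarrow> real) \<Rightarrow> bool" where
  "bessel_fusion smul ip I W w \<longleftrightarrow>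
     (\<forall>i\<in>I. closed_subspace smul (W i) \<and> 0 < w i) \<and>
     (\<exists>B. \<forall>f. (\<lambda>i. (w i)\<^sup>2 * (norm (orth_proj ip (W i) f))\<^sup>2) summable_on I \<and>
        (\<Sum>\<^sub>\<infinity>i\<in>I. (w i)\<^sup>2 * (norm (orth_proj ip (W i) f))\<^sup>2) \<le> B * (norm f)\<^sup>2)"

definition K_fusion_frame ::
    "('k::rc_field \<Rightarrow> 'a::banach \<Rightarrow> 'a) \<Rightarrow> ('a \<Rightarrow> 'a \<Rightarrow> 'k) \<Rightarrow> ('a \<Rightarrow> 'a)
      \<Rightarrow> 'i set \<Rightarrow> ('i \<Rightarrow> 'a set) \<Rightarrow> ('i \<Rightarrow> real) \<Rightarrow> bool" where
  "K_fusion_frame smul ip K I W w \<longleftrightarrow>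
     bessel_fusion smul ip I W w \<and>
     (\<exists>A>0. \<forall>f. A * (norm (adjoint_on ip UNIV K f))\<^sup>2
        \<le> (\<Sum>\<^sub>\<infinity>i\<in>I. (w i)\<^sup>2 * (norm (orth_proj ip (W i) f))\<^sup>2))"

definition fusion_operator ::
    "('a::banach \<Rightarrow> 'a \<Rightarrow> 'k::rc_field) \<Rightarrow> 'i set \<Rightarrow> ('i \<Rightarrow> 'a set) \<Rightarrow> ('i \<Rightarrow> real) \<Rightarrow> 'a \<Rightarrow> 'a" where
  "fusion_operator ip I W w f = (\<Sum>\<^sub>\<infinity>i\<in>I. (w i)\<^sup>2 *\<^sub>R orth_proj ip (W i) f)"

text \<open>
  \<open>(S\<^sub>W\<^sup>-\<^sup>1)\<^sup>* : R(K) \<rightarrow> S\<^sub>W(R(K))\<close>, where \<open>S\<^sub>W\<^sup>-\<^sup>1 : S\<^sub>W(R(K)) \<rightarrow> R(K)\<close> inverts the restriction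
  of the frame operator to \<open>R(K)\<close>.
\<close>

definition fusion_inv_adjoint ::
    "('a::banach \<Rightarrow> 'a \<Rightarrow> 'k::rc_field) \<Rightarrow> ('a \<Rightarrow> 'a)
      \<Rightarrow> 'i set \<Rightarrow> ('i \<Rightarrow> 'a set) \<Rightarrow> ('i \<Rightarrow> real) \<Rightarrow> 'a \<Rightarrow> 'a" where
  "fusion_inv_adjoint ip K I W w =
     (let S = fusion_operator ip I W w
      in adjoint_on ip (S ` range K) (inv_into (range K) S))"

definition fusion_K_dual ::
    "('k::rc_field \<Rightarrow> 'a::banach \<Rightarrow> 'a) \<Rightarrow> ('a \<Rightarrow> 'a \<Rightarrow> 'k) \<Rightarrow> ('a \<Rightarrow> 'a) \<Rightarrow> 'i set
      \<Rightarrow> ('i \<Rightarrow> 'a set) \<Rightarrow> ('i \<Rightarrow> real) \<Rightarrow> ('i \<Rightarrow> 'a set) \<Rightarrow> ('i \<Rightarrow> real) \<Rightarrow> bool" where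
  "fusion_K_dual smul ip K I V v W w \<longleftrightarrow>
     K_fusion_frame smul ip K I W w \<and> bessel_fusion smul ip I V v \<and>
     (\<forall>f. ((\<lambda>i. (w i * v i) *\<^sub>R orth_proj ip (range K) (orth_proj ip (W i)
              (fusion_inv_adjoint ip K I W w (K (orth_proj ip (V i) f))))) has_sum K f) I)"

definition bessel_seq ::
    "('a::banach \<Rightarrow> 'a \<Rightarrow> 'k::rc_field) \<Rightarrow> 'j set \<Rightarrow> ('j \<Rightarrow> 'a) \<Rightarrow> bool" where
  "bessel_seq ip J g \<longleftrightarrow>
     (\<exists>B. \<forall>f. (\<lambda>j. (norm (ip f (g j)))\<^sup>2) summable_on J \<and>
        (\<Sum>\<^sub>\<infinity>j\<in>J. (norm (ip f (g j)))\<^sup>2) \<le> B * (norm f)\<^sup>2)"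

definition seq_K_dual ::
    "('k::rc_field \<Rightarrow> 'a::banach \<Rightarrow> 'a) \<Rightarrow> ('a \<Rightarrow> 'a \<Rightarrow> 'k) \<Rightarrow> ('a \<Rightarrow> 'a)
      \<Rightarrow> 'j set \<Rightarrow> ('j \<Rightarrow> 'a) \<Rightarrow> ('j \<Rightarrow> 'a) \<Rightarrow> bool" where
  "seq_K_dual smul ip K J G F \<longleftrightarrow>
     bessel_seq ip J G \<and> (\<forall>f. ((\<lambda>j. smul (ip f (G j)) (F j)) has_sum K f) J)"

definition frame_for ::
    "('a::banach \<Rightarrow> 'a \<Rightarrow> 'k::rc_field) \<Rightarrow> 'a set \<Rightarrow> 'j set \<Rightarrow> ('j \<Rightarrow> 'a) \<Rightarrow> real \<Rightarrow> real \<Rightarrow> bool" where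
  "frame_for ip U J g A B \<longleftrightarrow>
     0 < A \<and> A \<le> B \<and> (\<forall>j\<in>J. g j \<in> U) \<and>
     (\<forall>f\<in>U. (\<lambda>j. (norm (ip f (g j)))\<^sup>2) summable_on J \<and>
        A * (norm f)\<^sup>2 \<le> (\<Sum>\<^sub>\<infinity>j\<in>J. (norm (ip f (g j)))\<^sup>2) \<and>
        (\<Sum>\<^sub>\<infinity>j\<in>J. (norm (ip f (g j)))\<^sup>2) \<le> B * (norm f)\<^sup>2)"

text \<open>
  The uniform bounds are stated in the extended reals, so that \<open>I = {}\<close> is harmless.
\<close>

definition local_frames ::
    "('a::banach \<Rightarrow> 'a \<Rightarrow> 'k::rc_field) \<Rightarrow> 'i set \<Rightarrow> ('i \<Rightarrow> 'a set) \<Rightarrow> ('i \<Rightarrow> 'j set)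
      \<Rightarrow> ('i \<Rightarrow> 'j \<Rightarrow> 'a) \<Rightarrow> ('i \<Rightarrow> real) \<Rightarrow> ('i \<Rightarrow> real) \<Rightarrow> bool" where
  "local_frames ip I V J g A B \<longleftrightarrow>
     (\<forall>i\<in>I. frame_for ip (V i) (J i) (g i) (A i) (B i)) \<and>
     0 < (INF i\<in>I. ereal (A i)) \<and> (SUP i\<in>I. ereal (B i)) < \<infinity>"

definition frame_operator ::
    "('k::rc_field \<Rightarrow> 'a::banach \<Rightarrow> 'a) \<Rightarrow> ('a \<Rightarrow> 'a \<Rightarrow> 'k) \<Rightarrow> 'j set \<Rightarrow> ('j \<Rightarrow> 'a) \<Rightarrow> 'a \<Rightarrow> 'a" where
  "frame_operator smul ip J g f = (\<Sum>\<^sub>\<infinity>j\<in>J. smul (ip f (g j)) (g j))"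

definition canonical_dual ::
    "('k::rc_field \<Rightarrow> 'a::banach \<Rightarrow> 'a) \<Rightarrow> ('a \<Rightarrow> 'a \<Rightarrow> 'k)
      \<Rightarrow> 'a set \<Rightarrow> 'j set \<Rightarrow> ('j \<Rightarrow> 'a) \<Rightarrow> 'j \<Rightarrow> 'a" where
  "canonical_dual smul ip U J g j = inv_into U (frame_operator smul ip J g) (g j)"

end

theory Submission
  imports Defs
begin

text \<open>
  Write \<open>L = (S\<^sub>W\<^sup>-\<^sup>1)\<^sup>*K\<close>. In \<open>V\<^sub>i\<close> the canonical dual of the local frame reconstructs the projection of any
  vector: the series of \<open>\<langle>f, g\<^sub>i\<^sub>j\<rangle>\<close> times the dual vectors converges to \<open>\<pi>f\<close>, where \<open>\<pi>\<close> projects onto \<open>V\<^sub>i\<close>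
  (\<open>canonical_dual_reconstruction\<close>). Applying the bounded operator \<open>\<omega>\<^sub>i\<upsilon>\<^sub>i\<pi>\<^sub>R\<pi>\<^sub>WL\<close> term by term, the \<open>i\<close>-th term of the
  fusion series is the sum of the \<open>i\<close>-th block of the double series that defines duality of \<open>G\<close> and \<open>F\<close>
  (\<open>inner_series_has_sum\<close>). So the two series have the same sum as soon as both converge.

  An unconditionally convergent double series can be summed by blocks, but convergence of the sum of the
  block sums says nothing about the double series; the point is that the latter \<^emph>\<open>always\<close>
  converges unconditionally (\<open>double_series_summable\<close>). Indeed \<open>G\<close> is a Bessel sequence because \<open>V\<close> is a Bessel
  fusion sequence and the upper local bounds are uniform, and \<open>F\<close> is one because \<open>L\<close> is bounded, \<open>W\<close> is a
  Bessel fusion sequence and the canonical duals have uniform bounds, the lower local bounds being bounded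
  away from zero (\<open>bessel_seq_local_frames\<close>, \<open>transported_dual_bessel_bound\<close>). Square-summable coefficients
  against a Bessel sequence give an unconditionally convergent series (\<open>synthesis_summable\<close>).

  That \<open>L\<close> is a bounded operator is where the closed range of \<open>K\<close> and the lower fusion frame bound
  enter (\<open>bounded_operator_fusion_inv_adjoint\<close>): by uniform boundedness \<open>K\<^sup>*\<close> is bounded below on \<open>R(K)\<close>, hence
  so is \<open>S\<^sub>W\<close>, and its inverse there is bounded. Projections, the Riesz representation, adjoints and
  inverses of operators bounded below are developed over the abstract scalar field first.
\<close>


section \<open>Conjugation of scalars\<close>

lemma scalar_conj_zero [simp]: "scalar_conj 0 = (0 :: 'k::rc_field)"
  using scalar_conj_add[of 0 "0::'k"] by simp

lemma mult_scalar_conj_of_real: "x * scalar_conj x = (of_real ((norm x)\<^sup>2) :: 'k::rc_field)"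
  unfolding mult_scalar_conj of_real_def ..

lemma norm_scalar_conj [simp]: "norm (scalar_conj x) = norm (x :: 'k::rc_field)"
proof (cases "x = 0")
  case False
  have "norm x * norm (scalar_conj x) = norm x * norm x"
    using arg_cong[OF mult_scalar_conj_of_real[of x], of norm]
    by (simp add: norm_mult power2_eq_square)
  then show ?thesis using False by simp
qed simp

lemma scalar_conj_of_real [simp]: "scalar_conj (of_real r) = (of_real r :: 'k::rc_field)"
proof (cases "r = 0")
  case False
  have "of_real r * scalar_conj (of_real r) = of_real r * (of_real r :: 'k)"
    using mult_scalar_conj_of_real[of "of_real r :: 'k"]
    by (simp add: power2_eq_square flip: of_real_mult)
  then show ?thesis using False by simp
qed simp

lemma scalar_conj_scalar_conj [simp]: "scalar_conj (scalar_conj x) = (x :: 'k::rc_field)"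
proof (cases "x = 0")
  case False
  then have nz: "scalar_conj x \<noteq> 0"
    by (metis norm_scalar_conj norm_eq_zero)
  have "scalar_conj x * scalar_conj (scalar_conj x) = scalar_conj x * x"
    using mult_scalar_conj_of_real[of x] mult_scalar_conj_of_real[of "scalar_conj x"]
    by (simp add: mult.commute)
  then show ?thesis using nz by simp
qed simp

section \<open>Sums of nonnegative families\<close>

lemma nonneg_finite_sums_bounded:
  fixes f :: "'i \<Rightarrow> real"
  assumes "\<And>i. i \<in> A \<Longrightarrow> 0 \<le> f i" and "\<And>E. finite E \<Longrightarrow> E \<subseteq> A \<Longrightarrow> sum f E \<le> C"
  shows "f summable_on A" and "infsum f A \<le> C"
proof -
  show "f summable_on A"
    using assms by (intro nonneg_bdd_above_summable_on bdd_aboveI2[where M = C]) auto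
  then show "infsum f A \<le> C"
    using has_sum_le_finite_sums[OF has_sum_infsum] assms(2) by blast
qed

lemma finite_Sigma_sum_le:
  fixes f :: "'i \<times> 'j \<Rightarrow> real"
  assumes inner: "\<And>i E. i \<in> I \<Longrightarrow> finite E \<Longrightarrow> E \<subseteq> J i \<Longrightarrow> (\<Sum>j\<in>E. f (i, j)) \<le> p i"
    and outer: "\<And>E. finite E \<Longrightarrow> E \<subseteq> I \<Longrightarrow> sum p E \<le> C"
    and E: "finite E" "E \<subseteq> Sigma I J"
  shows "sum f E \<le> C"
proof -
  define E' where "E' i = {j. (i, j) \<in> E}" for i
  have E'_finite: "finite (E' i)" for i
    using E(1) by (rule finite_subset[rotated, OF finite_imageI[of E snd]]) (force simp: E'_def)
  have "E = Sigma (fst ` E) E'" by (force simp: E'_def)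
  then have "sum f E = (\<Sum>i\<in>fst ` E. \<Sum>j\<in>E' i. f (i, j))"
    using E(1) E'_finite by (subst sum.Sigma) auto
  also have "\<dots> \<le> (\<Sum>i\<in>fst ` E. p i)"
    using E(2) E'_finite by (intro sum_mono inner) (auto simp: E'_def)
  also have "\<dots> \<le> C" using E by (intro outer) auto
  finally show ?thesis .
qed

section \<open>Geometry of the inner product\<close>

context hilbert_space
begin

lemma scaleR_eq_smul: "r *\<^sub>R x = smul (of_real r) x"
  by (simp add: scale_of_real)

lemma ip_zero_left [simp]: "ip 0 y = 0"
  using ip_add_left[of 0 0 y] by simp

lemma ip_zero_right [simp]: "ip y 0 = 0"
  by (subst ip_conj_sym) simp

lemma ip_add_right: "ip x (y + z) = ip x y + ip x z"
  by (metis ip_add_left ip_conj_sym scalar_conj_add)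

lemma ip_scale_right: "ip x (smul c y) = scalar_conj c * ip x y"
  by (metis ip_scale_left ip_conj_sym scalar_conj_mult)

lemma ip_diff_left: "ip (x - y) z = ip x z - ip y z"
  using ip_add_left[of "x - y" y z] by (simp add: algebra_simps)

lemma ip_diff_right: "ip z (x - y) = ip z x - ip z y"
  using ip_add_right[of z "x - y" y] by (simp add: algebra_simps)

lemma ip_scaleR_left: "ip (r *\<^sub>R x) y = of_real r * ip x y"
  by (simp add: scaleR_eq_smul ip_scale_left)

lemma ip_scaleR_right: "ip x (r *\<^sub>R y) = of_real r * ip x y"
  by (simp add: scaleR_eq_smul ip_scale_right)

lemma ip_sum_left: "ip (\<Sum>i\<in>E. u i) y = (\<Sum>i\<in>E. ip (u i) y)"
  by (induction E rule: infinite_finite_induct) (auto simp: ip_add_left)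

lemma norm_ip_commute: "norm (ip x y) = norm (ip y x)"
  by (subst ip_conj_sym) simp

lemma ip_eq_0_commute: "ip x y = 0 \<longleftrightarrow> ip y x = 0"
  by (metis norm_ip_commute norm_eq_zero)

lemma ip_ext:
  assumes "\<And>z. ip z x = ip z y"
  shows "x = y"
proof -
  have "ip (x - y) (x - y) = 0"
    using assms by (simp add: ip_diff_right)
  then show ?thesis by (simp add: ip_self)
qed

lemma norm_smul: "norm (smul c x) = norm c * norm x"
proof -
  have "of_real ((norm (smul c x))\<^sup>2) = (of_real ((norm c * norm x)\<^sup>2) :: 'k)"
  proof -
    have "ip (smul c x) (smul c x) = (c * scalar_conj c) * ip x x"
      by (simp add: ip_scale_left ip_scale_right)
    then show ?thesis
      unfolding mult_scalar_conj_of_real ip_self by (simp add: power_mult_distrib)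
  qed
  then have "(norm (smul c x))\<^sup>2 = (norm c * norm x)\<^sup>2"
    using of_real_eq_iff by blast
  then show ?thesis by (simp add: power2_eq_iff_nonneg)
qed

lemma bounded_linear_smul_right: "bounded_linear (smul c)"
  by (rule bounded_linear_intro[where K = "norm c"])
     (simp_all add: scale_right_distrib norm_smul scaleR_eq_smul mult.commute)

lemma pythagoras:
  assumes "ip x y = 0"
  shows "(norm (x + y))\<^sup>2 = (norm x)\<^sup>2 + (norm y)\<^sup>2"
proof -
  have "ip y x = 0" using assms ip_eq_0_commute by blast
  then have "of_real ((norm (x + y))\<^sup>2) = (of_real ((norm x)\<^sup>2 + (norm y)\<^sup>2) :: 'k)"
    unfolding of_real_add ip_self[symmetric] by (simp add: assms ip_add_left ip_add_right)
  then show ?thesis using of_real_eq_iff by blast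
qed

lemma parallelogram:
  fixes x y :: 'a
  shows "(norm (x + y))\<^sup>2 + (norm (x - y))\<^sup>2 = 2 * (norm x)\<^sup>2 + 2 * (norm y)\<^sup>2"
proof -
  have "of_real ((norm (x + y))\<^sup>2 + (norm (x - y))\<^sup>2)
      = (of_real (2 * (norm x)\<^sup>2 + 2 * (norm y)\<^sup>2) :: 'k)"
    unfolding of_real_add of_real_mult ip_self[symmetric]
    by (simp add: ip_add_left ip_add_right ip_diff_left ip_diff_right)
  then show ?thesis using of_real_eq_iff by blast
qed

text \<open>The choice of the coefficient \<open>\<langle>x, y\<rangle> / \<parallel>y\<parallel>\<^sup>2\<close> makes the remainder orthogonal to \<open>y\<close>;
  Cauchy--Schwarz and the variational characterisation of projections both follow from it.\<close>

lemma norm_split_along: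
  assumes "y \<noteq> 0" and "c = ip x y / of_real ((norm y)\<^sup>2)"
  shows "(norm x)\<^sup>2 = (norm (x - smul c y))\<^sup>2 + (norm c * norm y)\<^sup>2"
proof -
  have "ip (x - smul c y) y = 0"
    using assms by (simp add: ip_diff_left ip_scale_left ip_self)
  then have "ip (x - smul c y) (smul c y) = 0"
    by (simp add: ip_scale_right)
  from pythagoras[OF this] show ?thesis by (simp add: norm_smul)
qed

lemma Cauchy_Schwarz: "norm (ip x y) \<le> norm x * norm y"
proof (cases "y = 0")
  case False
  define c where "c = ip x y / of_real ((norm y)\<^sup>2)"
  have "(norm c * norm y)\<^sup>2 \<le> (norm x)\<^sup>2"
    using norm_split_along[OF False c_def] by simp
  then have "norm c * norm y \<le> norm x"
    using power2_le_imp_le norm_ge_zero by blast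
  moreover have "norm c * norm y = norm (ip x y) / norm y"
    using False by (simp add: c_def norm_divide norm_mult power2_eq_square)
  ultimately show ?thesis using False by (simp add: divide_le_eq)
qed simp

lemma bounded_linear_ip_left: "bounded_linear (\<lambda>x. ip x y)"
  by (rule bounded_linear_intro[where K = "norm y"])
     (simp_all add: ip_add_left ip_scaleR_left Cauchy_Schwarz scaleR_conv_of_real)

lemma norm_le_ip_bound:
  assumes "0 \<le> C" and "norm (ip x x) \<le> C * norm x"
  shows "norm x \<le> C"
proof (cases "x = 0")
  case False
  have "norm x * norm x \<le> C * norm x"
    using assms(2) by (simp add: ip_self norm_power power2_eq_square norm_mult)
  then show ?thesis using False by simp
qed (use assms in simp)

section \<open>Bounded operators and orthogonal projections\<close>

lemma bounded_operatorI:
  assumes "\<And>x y. T (x + y) = T x + T y" and "\<And>c x. T (smul c x) = smul c (T x)"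
    and "\<And>x. norm (T x) \<le> C * norm x"
  shows "bounded_operator smul T"
proof -
  have "bounded_linear T"
    by (rule bounded_linear_intro[where K = C])
       (simp_all add: assms scaleR_eq_smul mult.commute)
  then show ?thesis
    using assms vector_space_axioms by (simp add: bounded_operator_def Vector_Spaces.linear_iff)
qed

lemma bounded_operatorD:
  assumes "bounded_operator smul T"
  shows "T (x + y) = T x + T y" and "T (smul c x) = smul c (T x)"
    and "T (x - y) = T x - T y" and "T 0 = 0" and "bounded_linear T"
  using assms by (auto simp: bounded_operator_def Vector_Spaces.linear_iff linear_simps)

lemma bounded_operator_bound:
  assumes "bounded_operator smul T"
  obtains C where "C > 0" and "\<And>x. norm (T x) \<le> C * norm x"
  using bounded_linear.pos_bounded[OF bounded_operatorD(5)[OF assms]] by (auto simp: mult.commute)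

lemma bounded_operator_compose:
  assumes "bounded_operator smul S" "bounded_operator smul T"
  shows "bounded_operator smul (\<lambda>x. S (T x))"
  using assms bounded_linear_compose[of S T] unfolding bounded_operator_def Vector_Spaces.linear_iff by auto

lemma closed_subspaceD:
  assumes "closed_subspace smul U"
  shows "0 \<in> U" and "x \<in> U \<Longrightarrow> y \<in> U \<Longrightarrow> x + y \<in> U" and "x \<in> U \<Longrightarrow> smul c x \<in> U"
    and "x \<in> U \<Longrightarrow> y \<in> U \<Longrightarrow> x - y \<in> U" and "x \<in> U \<Longrightarrow> r *\<^sub>R x \<in> U" and "closed U"
proof -
  have U: "subspace U" "closed U" using assms by (auto simp: closed_subspace_def)
  note closure_rules = subspace_0[OF U(1)] subspace_add[OF U(1)] subspace_scale[OF U(1)]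
    subspace_diff[OF U(1)]
  show "0 \<in> U" and "x \<in> U \<Longrightarrow> y \<in> U \<Longrightarrow> x + y \<in> U" and "x \<in> U \<Longrightarrow> smul c x \<in> U"
    and "x \<in> U \<Longrightarrow> y \<in> U \<Longrightarrow> x - y \<in> U" and "x \<in> U \<Longrightarrow> r *\<^sub>R x \<in> U" and "closed U"
    unfolding scaleR_eq_smul using U(2) closure_rules by blast+
qed

lemma closed_subspace_range:
  assumes "bounded_operator smul T" "closed (range T)"
  shows "closed_subspace smul (range T)"
proof -
  note T = bounded_operatorD(1,2,4)[OF assms(1)]
  have "subspace (range T)"
  proof (rule subspaceI)
    show "0 \<in> range T" using rangeI[of T 0] T(3) by simp
    show "x + y \<in> range T" if xy: "x \<in> range T" "y \<in> range T" for x y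
    proof -
      obtain a b where "x = T a" "y = T b" using xy by blast
      then show ?thesis using rangeI[of T "a + b"] T(1) by simp
    qed
    show "smul c x \<in> range T" if x: "x \<in> range T" for c x
    proof -
      obtain a where "x = T a" using x by blast
      then show ?thesis using rangeI[of T "smul c a"] T(2) by simp
    qed
  qed
  then show ?thesis using assms(2) by (simp add: closed_subspace_def)
qed

text \<open>By the parallelogram law, points of \<open>U\<close> that nearly minimise the distance to \<open>x\<close> are
  close to each other, so a minimising sequence converges; at its limit \<open>u\<close> no multiple of a
  \<open>y \<in> U\<close> can be subtracted to shorten \<open>x - u\<close>, which forces orthogonality.\<close>

lemma orthogonal_projection_exists:
  assumes U: "closed_subspace smul U"
  shows "\<exists>u\<in>U. \<forall>y\<in>U. ip (x - u) y = 0"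
proof -
  define D where "D = (INF u\<in>U. (norm (x - u))\<^sup>2)"
  have bdd: "bdd_below ((\<lambda>u. (norm (x - u))\<^sup>2) ` U)"
    by (intro bdd_belowI[where m = 0]) auto
  have D_le: "D \<le> (norm (x - u))\<^sup>2" if "u \<in> U" for u
    unfolding D_def using that bdd by (intro cINF_lower) auto
  have "\<exists>u\<in>U. (norm (x - u))\<^sup>2 < D + 1 / real (Suc n)" for n
  proof -
    have "D < D + 1 / real (Suc n)" by simp
    then show ?thesis
      unfolding D_def using closed_subspaceD(1)[OF U] bdd
      by (subst (asm) cINF_less_iff) auto
  qed
  then obtain u where u: "\<And>n. u n \<in> U" "\<And>n. (norm (x - u n))\<^sup>2 < D + 1 / real (Suc n)"
    by metis
  have close: "(norm (u m - u n))\<^sup>2 \<le> 2 / real (Suc m) + 2 / real (Suc n)" for m n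
  proof -
    have mid: "(1/2) *\<^sub>R (u m + u n) \<in> U"
      using closed_subspaceD(2,5)[OF U] u(1) by blast
    have "(x - u n) + (x - u m) = 2 *\<^sub>R (x - (1/2) *\<^sub>R (u m + u n))"
      by (simp add: algebra_simps scaleR_2)
    then have "(norm ((x - u n) + (x - u m)))\<^sup>2 = 4 * (norm (x - (1/2) *\<^sub>R (u m + u n)))\<^sup>2"
      by (simp add: power_mult_distrib)
    with parallelogram[of "x - u n" "x - u m"] D_le[OF mid] u(2)[of m] u(2)[of n]
    show ?thesis by (simp add: algebra_simps)
  qed
  have "Cauchy u"
  proof (rule metric_CauchyI)
    fix e :: real assume e: "e > 0"
    then obtain N where N: "4 / e\<^sup>2 < real N" using reals_Archimedean2 by blast
    have "dist (u m) (u n) < e" if "m \<ge> N" "n \<ge> N" for m n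
    proof -
      have "2 / real (Suc k) < e\<^sup>2 / 2" if "k \<ge> N" for k
      proof -
        have "4 / e\<^sup>2 < real (Suc k)" using N that by linarith
        then show ?thesis using e by (simp add: field_simps)
      qed
      from this[OF that(1)] this[OF that(2)] close[of m n]
      have "(norm (u m - u n))\<^sup>2 < e\<^sup>2" by linarith
      then show ?thesis using e by (simp add: dist_norm power2_less_imp_less)
    qed
    then show "\<exists>N. \<forall>m\<ge>N. \<forall>n\<ge>N. dist (u m) (u n) < e" by blast
  qed
  then obtain p where p: "u \<longlonglongrightarrow> p"
    using Cauchy_convergent convergent_def by blast
  have pU: "p \<in> U"
    using closed_sequentially[OF closed_subspaceD(6)[OF U]] u(1) p by blast
  have "(norm (x - p))\<^sup>2 \<le> D"
  proof (rule LIMSEQ_le)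
    show "(\<lambda>n. (norm (x - u n))\<^sup>2) \<longlonglongrightarrow> (norm (x - p))\<^sup>2"
      by (intro tendsto_intros p)
    show "(\<lambda>n. D + 1 / real (Suc n)) \<longlonglongrightarrow> D"
      using LIMSEQ_inverse_real_of_nat_add[of D] by (simp add: inverse_eq_divide)
  qed (use u(2) less_imp_le in blast)
  moreover have "ip (x - p) y = 0" if y: "y \<in> U" and le: "(norm (x - p))\<^sup>2 \<le> D" for y
  proof (cases "y = 0")
    case False
    define c where "c = ip (x - p) y / of_real ((norm y)\<^sup>2)"
    have "p + smul c y \<in> U" using closed_subspaceD(2,3)[OF U] pU y by blast
    from D_le[OF this] le norm_split_along[OF False c_def]
    have "(norm c * norm y)\<^sup>2 \<le> 0" by (simp only: diff_diff_eq)
    then have "c = 0" using False by simp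
    then show ?thesis using False by (simp add: c_def)
  qed simp
  ultimately show ?thesis using pU by blast
qed

abbreviation proj :: "'a set \<Rightarrow> 'a \<Rightarrow> 'a" where "proj \<equiv> orth_proj ip"

context
  fixes U :: "'a set"
  assumes U: "closed_subspace smul U"
begin

lemma proj_unique:
  assumes "u \<in> U" and "\<And>y. y \<in> U \<Longrightarrow> ip (x - u) y = 0"
  shows "proj U x = u"
  unfolding orth_proj_def
proof (rule the_equality)
  fix u' assume u': "u' \<in> U \<and> (\<forall>y\<in>U. ip (x - u') y = 0)"
  then have d: "u - u' \<in> U" using assms(1) closed_subspaceD(4)[OF U] by blast
  have "ip (u - u') (u - u') = ip (x - u') (u - u') - ip (x - u) (u - u')"
    by (simp add: ip_diff_left)
  also have "\<dots> = 0" using d u' assms(2) by simp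
  finally show "u' = u" by (simp add: ip_self)
qed (use assms in blast)

lemma proj_mem: "proj U x \<in> U"
  and proj_orthogonal: "y \<in> U \<Longrightarrow> ip (x - proj U x) y = 0"
proof -
  obtain u where "u \<in> U" "\<forall>y\<in>U. ip (x - u) y = 0"
    using orthogonal_projection_exists[OF U] by blast
  moreover from this have "proj U x = u" using proj_unique by blast
  ultimately show "proj U x \<in> U" and "y \<in> U \<Longrightarrow> ip (x - proj U x) y = 0" by auto
qed

lemma proj_ident: "x \<in> U \<Longrightarrow> proj U x = x"
  by (rule proj_unique) auto

lemma ip_proj_left: "y \<in> U \<Longrightarrow> ip (proj U x) y = ip x y"
  using proj_orthogonal[of y x] by (simp add: ip_diff_left)

lemma ip_proj_right: "y \<in> U \<Longrightarrow> ip y (proj U x) = ip y x"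
  using ip_proj_left ip_conj_sym by metis

lemma ip_proj_swap: "ip (proj U x) y = ip x (proj U y)"
  using ip_proj_left[OF proj_mem] ip_proj_right[OF proj_mem] by metis

lemma ip_proj_self: "ip (proj U x) x = of_real ((norm (proj U x))\<^sup>2)"
  using ip_proj_right[OF proj_mem, of x x] by (simp add: ip_self)

lemma norm_proj_le: "norm (proj U x) \<le> norm x"
proof (rule norm_le_ip_bound)
  show "norm (ip (proj U x) (proj U x)) \<le> norm x * norm (proj U x)"
    using ip_proj_left[OF proj_mem] Cauchy_Schwarz by metis
qed simp

lemma bounded_operator_proj: "bounded_operator smul (proj U)"
proof (rule bounded_operatorI[where C = 1])
  show "proj U (x + y) = proj U x + proj U y" for x y
    using proj_orthogonal[of _ x] proj_orthogonal[of _ y]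
    by (intro proj_unique closed_subspaceD(2)[OF U] proj_mem)
       (simp add: add_diff_add ip_add_left)
  show "proj U (smul c x) = smul c (proj U x)" for c x
    using proj_orthogonal[of _ x]
    by (intro proj_unique closed_subspaceD(3)[OF U] proj_mem)
       (simp add: ip_diff_left ip_scale_left)
qed (simp add: norm_proj_le)

end

section \<open>Riesz representation and adjoints\<close>

text \<open>A nonzero bounded functional \<open>\<phi>\<close> is determined by any \<open>w\<close> orthogonal to its kernel, because
  \<open>\<phi>(w)x - \<phi>(x)w\<close> always lies in the kernel; rescaling \<open>w\<close> represents \<open>\<phi>\<close>.\<close>

lemma Riesz_representation:
  assumes add: "\<And>x y. \<phi> (x + y) = \<phi> x + \<phi> y" and scale: "\<And>c x. \<phi> (smul c x) = c * \<phi> x"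
    and bound: "\<And>x. norm (\<phi> x) \<le> C * norm x"
  shows "\<exists>u. \<forall>x. \<phi> x = ip x u"
proof (cases "\<forall>x. \<phi> x = 0")
  case True
  then show ?thesis by (intro exI[of _ 0]) simp
next
  case False
  then obtain z where z: "\<phi> z \<noteq> 0" by blast
  have lin: "bounded_linear \<phi>"
    by (rule bounded_linear_intro[where K = C])
       (simp_all add: add scale bound scaleR_eq_smul mult.commute[of _ C] scaleR_conv_of_real)
  have diff: "\<phi> (x - y) = \<phi> x - \<phi> y" for x y
    using lin by (simp add: linear_simps)
  define N where "N = {x. \<phi> x = 0}"
  have "closed (\<phi> -` {0})"
    by (intro continuous_closed_vimage closed_singleton linear_continuous_at lin)
  then have "closed N" by (simp add: N_def vimage_def)
  moreover have "subspace N"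
    by (rule subspaceI) (use lin in \<open>auto simp: N_def add scale linear_simps\<close>)
  ultimately have N: "closed_subspace smul N" by (simp add: closed_subspace_def)
  define w where "w = z - proj N z"
  have "\<phi> (proj N z) = 0" using proj_mem[OF N, of z] by (simp add: N_def)
  then have \<phi>w: "\<phi> w \<noteq> 0" using z by (simp add: w_def diff)
  then have w0: "w \<noteq> 0" using lin by (auto simp: linear_simps)
  have w_orth: "ip x w = 0" if "x \<in> N" for x
    using proj_orthogonal[OF N that, of z] ip_eq_0_commute w_def by blast
  have key: "\<phi> w * ip x w = \<phi> x * of_real ((norm w)\<^sup>2)" for x
  proof -
    have "smul (\<phi> w) x - smul (\<phi> x) w \<in> N" by (simp add: N_def diff scale)
    from w_orth[OF this] show ?thesis by (simp add: ip_diff_left ip_scale_left ip_self)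
  qed
  have "\<phi> x = ip x (smul (scalar_conj (\<phi> w / of_real ((norm w)\<^sup>2))) w)" for x
    using key[of x] w0 by (simp add: ip_scale_right field_simps)
  then show ?thesis by blast
qed

abbreviation adj :: "('a \<Rightarrow> 'a) \<Rightarrow> 'a \<Rightarrow> 'a" where "adj \<equiv> adjoint_on ip UNIV"

context
  fixes T :: "'a \<Rightarrow> 'a"
  assumes T: "bounded_operator smul T"
begin

lemma ip_adj: "ip (T x) y = ip x (adj T y)"
proof -
  obtain C where C: "\<And>x. norm (T x) \<le> C * norm x"
    using bounded_operator_bound[OF T] by blast
  have "\<exists>u. \<forall>x. ip (T x) y = ip x u"
  proof (rule Riesz_representation[where C = "C * norm y"])
    show "norm (ip (T x) y) \<le> C * norm y * norm x" for x
      using Cauchy_Schwarz[of "T x" y] mult_right_mono[OF C, of "norm y" x]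
      by (simp add: algebra_simps)
  qed (simp_all add: bounded_operatorD[OF T] ip_add_left ip_scale_left)
  then obtain u where u: "\<And>x. ip (T x) y = ip x u" by blast
  have "adj T y = u"
    unfolding adjoint_on_def by (rule the_equality) (use u ip_ext in auto)
  then show ?thesis using u by simp
qed

lemma ip_adj_left: "ip (adj T y) x = ip y (T x)"
  using ip_adj ip_conj_sym by metis

lemma norm_adj_le:
  assumes C: "\<And>x. norm (T x) \<le> C * norm x"
  shows "norm (adj T y) \<le> C * norm y"
proof (rule norm_le_ip_bound)
  have "0 \<le> C * norm y" using order_trans[OF norm_ge_zero C] .
  then show "0 \<le> C * norm y" .
  have "norm (ip (adj T y) (adj T y)) = norm (ip y (T (adj T y)))"
    by (simp add: ip_adj_left)
  also have "\<dots> \<le> norm y * (C * norm (adj T y))"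
    by (rule order_trans[OF Cauchy_Schwarz mult_left_mono[OF C]]) simp
  finally show "norm (ip (adj T y) (adj T y)) \<le> C * norm y * norm (adj T y)"
    by (simp add: algebra_simps)
qed

lemma bounded_operator_adj: "bounded_operator smul (adj T)"
proof -
  obtain C where C: "\<And>x. norm (T x) \<le> C * norm x"
    using bounded_operator_bound[OF T] by blast
  show ?thesis
  proof (rule bounded_operatorI[where T = "adj T", OF _ _ norm_adj_le[OF C]])
    show "adj T (x + y) = adj T x + adj T y" for x y
      by (rule ip_ext) (simp add: ip_add_right flip: ip_adj)
    show "adj T (smul c x) = smul c (adj T x)" for c x
      by (rule ip_ext) (simp add: ip_scale_right flip: ip_adj)
  qed
qed

text \<open>An operator defined only on a closed subspace has the same adjoint, up to projection, as any of
  its bounded extensions to the whole space.\<close>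

lemma adjoint_on_subspace:
  assumes U: "closed_subspace smul U" and eq: "\<And>x. x \<in> U \<Longrightarrow> R x = T x"
  shows "adjoint_on ip U R y = proj U (adj T y)"
  unfolding adjoint_on_def[of ip U R]
proof (rule the_equality)
  show "proj U (adj T y) \<in> U \<and> (\<forall>x\<in>U. ip (R x) y = ip x (proj U (adj T y)))"
    using proj_mem[OF U] by (simp add: eq ip_adj ip_proj_right[OF U])
  fix u assume u: "u \<in> U \<and> (\<forall>x\<in>U. ip (R x) y = ip x u)"
  then have "proj U (adj T y) = u"
  proof (intro proj_unique[OF U])
    fix x assume "x \<in> U"
    then have "ip x (adj T y - u) = 0" using u by (simp add: ip_diff_right eq flip: ip_adj)
    then show "ip (adj T y - u) x = 0" by (simp add: ip_eq_0_commute)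
  qed blast
  then show "u = proj U (adj T y)" ..
qed

end

section \<open>Operators bounded below on a closed subspace\<close>

context
  fixes S :: "'a \<Rightarrow> 'a" and U :: "'a set" and c :: real
  assumes S: "bounded_operator smul S" and U: "closed_subspace smul U" and c: "c > 0"
    and below: "\<forall>x\<in>U. c * norm x \<le> norm (S x)"
begin

lemma bounded_below_inj_on: "inj_on S U"
proof (rule inj_onI)
  fix x y assume xy: "x \<in> U" "y \<in> U" "S x = S y"
  then have "c * norm (x - y) \<le> norm (S (x - y))"
    using below closed_subspaceD(4)[OF U] by blast
  then show "x = y" using c xy(3) by (simp add: bounded_operatorD(3)[OF S] mult_le_0_iff)
qed

lemma closed_subspace_bounded_below_image: "closed_subspace smul (S ` U)"
  unfolding closed_subspace_def
proof
  note S' = bounded_operatorD(1,2,4)[OF S] and U' = closed_subspaceD[OF U]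
  show "subspace (S ` U)"
  proof (rule subspaceI)
    show "0 \<in> S ` U" using imageI[OF U'(1), of S] S'(3) by simp
    show "x + y \<in> S ` U" if xy: "x \<in> S ` U" "y \<in> S ` U" for x y
      using xy U'(2) by (auto simp flip: S'(1))
    show "smul a x \<in> S ` U" if "x \<in> S ` U" for a x
      using that U'(3) by (auto simp flip: S'(2))
  qed
  have "complete (S ` U)"
  proof (rule complete_isometric_image[OF c _ bounded_operatorD(5)[OF S]])
    show "Real_Vector_Spaces.subspace U"
      using U' by (auto simp: Real_Vector_Spaces.subspace_def)
    show "complete U" using U'(6) complete_eq_closed by blast
  qed (use below in blast)
  then show "closed (S ` U)" by (rule complete_imp_closed)
qed

text \<open>Composing with the projection onto the image extends the inverse to the whole space, so that
  boundedness and adjoints of it can be discussed there.\<close>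

definition bounded_below_inverse :: "'a \<Rightarrow> 'a" where
  "bounded_below_inverse y = inv_into U S (proj (S ` U) y)"

lemma bounded_below_inverse_mem: "bounded_below_inverse y \<in> U"
  unfolding bounded_below_inverse_def
  by (rule inv_into_into) (rule proj_mem[OF closed_subspace_bounded_below_image])

lemma bounded_below_inverse_right: "S (bounded_below_inverse y) = proj (S ` U) y"
  unfolding bounded_below_inverse_def
  by (rule f_inv_into_f) (rule proj_mem[OF closed_subspace_bounded_below_image])

lemma bounded_below_inverse_eq: "y \<in> S ` U \<Longrightarrow> bounded_below_inverse y = inv_into U S y"
  unfolding bounded_below_inverse_def
  by (simp add: proj_ident[OF closed_subspace_bounded_below_image])

lemma bounded_below_inverse_left: "x \<in> U \<Longrightarrow> bounded_below_inverse (S x) = x"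
  by (simp add: bounded_below_inverse_eq inv_into_f_f[OF bounded_below_inj_on])

lemma norm_bounded_below_inverse_le: "norm (bounded_below_inverse y) \<le> (1 / c) * norm y"
proof -
  have "c * norm (bounded_below_inverse y) \<le> norm (proj (S ` U) y)"
    using below[rule_format, OF bounded_below_inverse_mem, of y] by (simp add: bounded_below_inverse_right)
  also have "\<dots> \<le> norm y" by (rule norm_proj_le[OF closed_subspace_bounded_below_image])
  finally show ?thesis using c by (simp add: field_simps)
qed

lemma bounded_operator_bounded_below_inverse: "bounded_operator smul bounded_below_inverse"
proof (rule bounded_operatorI[OF _ _ norm_bounded_below_inverse_le])
  note P = bounded_operatorD[OF bounded_operator_proj[OF closed_subspace_bounded_below_image]]
  note inj = inj_onD[OF bounded_below_inj_on] and S' = bounded_operatorD[OF S]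
  show "bounded_below_inverse (x + y) = bounded_below_inverse x + bounded_below_inverse y" for x y
    by (rule inj) (simp_all add: bounded_below_inverse_mem closed_subspaceD[OF U] S' P
        bounded_below_inverse_right)
  show "bounded_below_inverse (smul a x) = smul a (bounded_below_inverse x)" for a x
    by (rule inj) (simp_all add: bounded_below_inverse_mem closed_subspaceD[OF U] S' P
        bounded_below_inverse_right)
qed

end

section \<open>Weak boundedness and operators with closed range\<close>

text \<open>The sets where all functionals in question are bounded by \<open>n\<close> are closed and exhaust the space, so
  by Baire one of them contains a ball.\<close>

lemma weakly_bounded_imp_bounded:
  assumes weak: "\<And>x. \<exists>C. \<forall>y\<in>Y. norm (ip x y) \<le> C"
  shows "\<exists>C. \<forall>y\<in>Y. norm y \<le> C"
proof -
  define F where "F n = {x. \<forall>y\<in>Y. norm (ip x y) \<le> real n}" for n :: nat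
  have closed_F: "closed (F n)" for n
  proof -
    have "F n = (\<Inter>y\<in>Y. {x. norm (ip x y) \<le> real n})" by (auto simp: F_def)
    moreover have "closed {x. norm (ip x y) \<le> real n}" for y
      by (intro closed_Collect_le continuous_intros
            linear_continuous_on[OF bounded_linear_ip_left])
    ultimately show ?thesis by auto
  qed
  have cover: "(\<Union>n. F n) = UNIV"
  proof -
    have "\<exists>n. x \<in> F n" for x
    proof -
      obtain C where C: "\<forall>y\<in>Y. norm (ip x y) \<le> C" using weak by blast
      obtain n where "C \<le> real n" using real_arch_simple by blast
      then show ?thesis unfolding F_def using C by (force intro: order_trans)
    qed
    then show ?thesis by blast
  qed
  have "\<exists>n. interior (F n) \<noteq> {}"
  proof (rule ccontr)
    assume "\<not> ?thesis"
    then have "(euclidean :: 'a topology) interior_of \<Union>(range F) = {}"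
      using closed_F Metric_space.metric_Baire_category_alt[OF Met_TC.Metric_space_axioms, of "range F"]
      by (auto simp: mcomplete_iff_complete complete_UNIV)
    then show False using cover by simp
  qed
  then obtain n x0 where "x0 \<in> interior (F n)" by blast
  then obtain r where r: "r > 0" "cball x0 r \<subseteq> F n"
    using open_contains_cball[of "interior (F n)"] interior_subset by (metis open_interior subset_trans)
  have "norm y \<le> 2 * real n / r" if y: "y \<in> Y" for y
  proof (cases "y = 0")
    case False
    (* the vector of norm r on which the functional of y is largest *)
    define e where "e = (r / norm y) *\<^sub>R y"
    have "norm e = r" using False r(1) by (simp add: e_def)
    then have "x0 \<in> F n" "x0 + e \<in> F n" using r by (auto simp: dist_norm)
    then have "norm (ip (x0 + e) y) \<le> n" "norm (ip x0 y) \<le> n" using y by (auto simp: F_def)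
    moreover have "ip e y = ip (x0 + e) y - ip x0 y" by (simp add: ip_add_left)
    ultimately have "norm (ip e y) \<le> 2 * n"
      using norm_triangle_ineq4[of "ip (x0 + e) y" "ip x0 y"] by simp
    moreover have "norm (ip e y) = r * norm y"
      using False r(1)
      by (simp add: e_def ip_scaleR_left ip_self norm_mult norm_divide power2_eq_square)
    ultimately show ?thesis using r(1) by (simp add: field_simps)
  qed (use r in simp)
  then show ?thesis by blast
qed

text \<open>The vectors \<open>y \<in> R(K)\<close> with \<open>\<parallel>K\<^sup>*y\<parallel> \<le> 1\<close> are weakly bounded, since only the component \<open>Kz\<close> of a test
  vector in \<open>R(K)\<close> matters and \<open>\<langle>Kz, y\<rangle> = \<langle>z, K\<^sup>*y\<rangle>\<close>.\<close>

lemma adj_bounded_below_on_closed_range: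
  assumes K: "bounded_operator smul K" and cl: "closed (range K)"
  shows "\<exists>C>0. \<forall>y\<in>range K. norm y \<le> C * norm (adj K y)"
proof -
  define Y where "Y = {y \<in> range K. norm (adj K y) \<le> 1}"
  note R = closed_subspace_range[OF K cl] and A = bounded_operatorD[OF bounded_operator_adj[OF K]]
  have "\<exists>C. \<forall>y\<in>Y. norm y \<le> C"
  proof (rule weakly_bounded_imp_bounded)
    fix x
    obtain z where z: "proj (range K) x = K z" using proj_mem[OF R, of x] by blast
    have "norm (ip x y) \<le> norm z" if "y \<in> Y" for y
    proof -
      have "ip x y = ip z (adj K y)"
        using that ip_proj_left[OF R, of y x] by (simp add: Y_def z ip_adj[OF K])
      then have "norm (ip x y) \<le> norm z * norm (adj K y)" by (simp add: Cauchy_Schwarz)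
      also have "\<dots> \<le> norm z * 1" using that by (intro mult_left_mono) (auto simp: Y_def)
      finally show ?thesis by simp
    qed
    then show "\<exists>C. \<forall>y\<in>Y. norm (ip x y) \<le> C" by blast
  qed
  then obtain C where C: "\<And>y. y \<in> Y \<Longrightarrow> norm y \<le> C" by blast
  (* arbitrary t rather than 1 / norm (adj K y), so that the case adj K y = 0 is covered too *)
  have scaled: "t * norm y \<le> C" if "y \<in> range K" "t * norm (adj K y) \<le> 1" "t \<ge> 0" for y t
  proof -
    have "t *\<^sub>R y \<in> range K" using that closed_subspaceD(5)[OF R] by blast
    moreover have "adj K (t *\<^sub>R y) = t *\<^sub>R adj K y" by (simp add: scaleR_eq_smul A(2))
    ultimately have "t *\<^sub>R y \<in> Y" using that by (simp add: Y_def)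
    from C[OF this] show ?thesis using that(3) by simp
  qed
  have "norm y \<le> max C 1 * norm (adj K y)" if y: "y \<in> range K" for y
  proof (cases "norm (adj K y) = 0")
    case True
    have "norm y = 0"
    proof (rule ccontr)
      assume "norm y \<noteq> 0"
      then have "(\<bar>C\<bar> + 1) / norm y * norm y \<le> C"
        using True y by (intro scaled) auto
      then show False using \<open>norm y \<noteq> 0\<close> by simp
    qed
    then show ?thesis by simp
  next
    case False
    have "1 / norm (adj K y) * norm y \<le> C" using False y by (intro scaled) auto
    then have "norm y \<le> C * norm (adj K y)" using False by (simp add: divide_le_eq)
    also have "\<dots> \<le> max C 1 * norm (adj K y)" by (intro mult_right_mono) auto
    finally show ?thesis .
  qed
  then show ?thesis by (intro exI[of _ "max C 1"]) auto
qed

section \<open>Unconditional convergence from square-summable coefficients\<close>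

text \<open>A Cauchy criterion: tails of \<open>u\<close> are controlled in square norm by tails of \<open>p\<close>. Orthogonal
  families, for instance, satisfy such a bound without being absolutely summable.\<close>

lemma summable_on_square_bound:
  fixes u :: "'i \<Rightarrow> 'a" and p :: "'i \<Rightarrow> real"
  assumes p: "p summable_on A" and C: "C > 0"
    and bound: "\<And>E. finite E \<Longrightarrow> E \<subseteq> A \<Longrightarrow> (norm (sum u E))\<^sup>2 \<le> C * sum p E"
  shows "u summable_on A"
proof -
  have "\<exists>P. eventually P (finite_subsets_at_top A) \<and>
      (\<forall>F F'. P F \<and> P F' \<longrightarrow> dist (sum u F) (sum u F') < e)" if e: "e > 0" for e
  proof -
    (* a tail of p below d forces the corresponding sum of u below e / 2 *)
    define d where "d = (e / 2)\<^sup>2 / (2 * C)"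
    have d: "d > 0" using e C by (simp add: d_def)
    obtain F0 where F0: "finite F0" "F0 \<subseteq> A" "dist (sum p F0) (infsum p A) \<le> d / 2"
      using infsum_finite_approximation[OF p, of "d / 2"] d by auto
    have p_nonneg: "0 \<le> p i" if "i \<in> A" for i
    proof -
      have "0 \<le> C * p i" using order_trans[OF zero_le_power2 bound[of "{i}"]] that by simp
      then show ?thesis using C by (simp add: zero_le_mult_iff)
    qed
    have tail: "norm (sum u F - sum u F0) < e / 2"
      if F: "finite F" "F \<subseteq> A" "F0 \<subseteq> F" for F
    proof -
      have "sum p F \<le> infsum p A" by (rule finite_sum_le_infsum[OF p F(1,2)]) (use p_nonneg in auto)
      then have tail_lt: "sum p (F - F0) < d"
        using F0(3) d unfolding sum_diff[OF F(1,3)] dist_real_def by linarith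
      have "(norm (sum u (F - F0)))\<^sup>2 \<le> C * sum p (F - F0)" using F by (intro bound) auto
      also have "\<dots> < C * d" using C tail_lt by simp
      also have "C * d < (e / 2)\<^sup>2" using C e by (simp add: d_def)
      finally have "norm (sum u (F - F0)) < e / 2"
        by (rule power2_less_imp_less) (use e in simp)
      then show ?thesis by (simp add: sum_diff[OF F(1,3)])
    qed
    have near: "dist (sum u F) (sum u F') < e"
      if "(finite F \<and> F0 \<subseteq> F \<and> F \<subseteq> A) \<and> finite F' \<and> F0 \<subseteq> F' \<and> F' \<subseteq> A" for F F'
      using tail[of F] tail[of F'] that dist_triangle_half_l[of "sum u F" "sum u F0" e "sum u F'"]
      by (simp add: dist_norm norm_minus_commute)
    have ev: "eventually (\<lambda>F. finite F \<and> F0 \<subseteq> F \<and> F \<subseteq> A) (finite_subsets_at_top A)"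
      using F0 by (auto simp: eventually_finite_subsets_at_top)
    show ?thesis
      by (rule exI, rule conjI[OF ev], intro allI impI near)
  qed
  then have "cauchy_filter (filtermap (sum u) (finite_subsets_at_top A))"
    by (simp add: cauchy_filter_metric_filtermap)
  then obtain L where "(sum u \<longlongrightarrow> L) (finite_subsets_at_top A)"
    using complete_uniform[where S = "UNIV :: 'a set"] complete_UNIV by (force simp: filterlim_def)
  then show ?thesis by (auto simp: summable_on_def has_sum_def)
qed

text \<open>Pairing a partial sum with itself and applying Cauchy--Schwarz to the coefficients leaves a factor
  of its own norm on the right, which cancels. Taking \<open>u\<^sub>i = c\<^sub>i f\<^sub>i\<close>, \<open>a\<^sub>i = |c\<^sub>i|\<close>, \<open>q\<^sub>i(h) = |\<langle>h, f\<^sub>i\<rangle>|\<close> gives the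
  synthesis operator of a Bessel sequence; \<open>u\<^sub>i = \<omega>\<^sub>i\<^sup>2\<pi>\<^sub>if\<close>, \<open>a\<^sub>i = q\<^sub>i(f)\<close>, \<open>q\<^sub>i(h) = \<omega>\<^sub>i\<parallel>\<pi>\<^sub>ih\<parallel>\<close> gives a fusion
  frame operator.\<close>

lemma norm_synthesis_le:
  assumes ip_u: "\<And>i h. i \<in> E \<Longrightarrow> norm (ip (u i) h) \<le> a i * q i h"
    and q: "\<And>h. (\<Sum>i\<in>E. (q i h)\<^sup>2) \<le> B * (norm h)\<^sup>2" and B: "B \<ge> 0"
  shows "(norm (\<Sum>i\<in>E. u i))\<^sup>2 \<le> B * (\<Sum>i\<in>E. (a i)\<^sup>2)"
proof -
  define x where "x = (\<Sum>i\<in>E. u i)"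
  have "norm (ip x x) \<le> (\<Sum>i\<in>E. norm (ip (u i) x))"
    by (subst x_def, subst ip_sum_left) (rule norm_sum)
  also have "\<dots> \<le> (\<Sum>i\<in>E. a i * q i x)" by (intro sum_mono ip_u)
  finally have le: "norm (ip x x) \<le> (\<Sum>i\<in>E. a i * q i x)" .
  have "(norm (ip x x))\<^sup>2 \<le> (\<Sum>i\<in>E. a i * q i x)\<^sup>2"
    using le by (intro power_mono) auto
  also have "\<dots> \<le> (\<Sum>i\<in>E. (a i)\<^sup>2) * (\<Sum>i\<in>E. (q i x)\<^sup>2)" by (rule Cauchy_Schwarz_ineq_sum)
  also have "\<dots> \<le> (\<Sum>i\<in>E. (a i)\<^sup>2) * (B * (norm x)\<^sup>2)"
    by (intro mult_left_mono q sum_nonneg) auto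
  finally have "(norm x)\<^sup>2 * (norm x)\<^sup>2 \<le> (B * (\<Sum>i\<in>E. (a i)\<^sup>2)) * (norm x)\<^sup>2"
    by (simp add: ip_self norm_mult power2_eq_square ac_simps)
  moreover have "0 \<le> B * (\<Sum>i\<in>E. (a i)\<^sup>2)" using B by (simp add: sum_nonneg)
  ultimately have "(norm x)\<^sup>2 \<le> B * (\<Sum>i\<in>E. (a i)\<^sup>2)"
    by (cases "x = 0") (simp, simp only: mult_le_cancel_right zero_less_power2 zero_less_norm_iff, simp)
  then show ?thesis by (simp add: x_def)
qed

lemma synthesis_summable:
  assumes ip_u: "\<And>i h. i \<in> A \<Longrightarrow> norm (ip (u i) h) \<le> a i * q i h"
    and q: "\<And>E h. finite E \<Longrightarrow> E \<subseteq> A \<Longrightarrow> (\<Sum>i\<in>E. (q i h)\<^sup>2) \<le> B * (norm h)\<^sup>2"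
    and B: "B > 0" and a: "(\<lambda>i. (a i)\<^sup>2) summable_on A"
  shows "u summable_on A"
proof (rule summable_on_square_bound[OF a B])
  fix E assume E: "finite E" "E \<subseteq> A"
  show "(norm (sum u E))\<^sup>2 \<le> B * (\<Sum>i\<in>E. (a i)\<^sup>2)"
    by (rule norm_synthesis_le[where q = q, OF ip_u q[OF E]]) (use E B in auto)
qed

lemma norm_infsum_synthesis_le:
  assumes ip_u: "\<And>i h. i \<in> A \<Longrightarrow> norm (ip (u i) h) \<le> a i * q i h"
    and q: "\<And>E h. finite E \<Longrightarrow> E \<subseteq> A \<Longrightarrow> (\<Sum>i\<in>E. (q i h)\<^sup>2) \<le> B * (norm h)\<^sup>2"
    and B: "B > 0" and a: "(\<lambda>i. (a i)\<^sup>2) summable_on A"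
  shows "(norm (infsum u A))\<^sup>2 \<le> B * (\<Sum>\<^sub>\<infinity>i\<in>A. (a i)\<^sup>2)"
proof (rule tendsto_upperbound)
  have "(u has_sum infsum u A) A"
    using synthesis_summable[OF ip_u q B a] has_sum_infsum by blast
  then show "((\<lambda>E. (norm (sum u E))\<^sup>2) \<longlongrightarrow> (norm (infsum u A))\<^sup>2) (finite_subsets_at_top A)"
    unfolding has_sum_def by (intro tendsto_intros)
  show "\<forall>\<^sub>F E in finite_subsets_at_top A.
      (norm (sum u E))\<^sup>2 \<le> B * (\<Sum>\<^sub>\<infinity>i\<in>A. (a i)\<^sup>2)"
  proof (rule eventually_finite_subsets_at_top_weakI)
    fix E assume E: "finite E" "E \<subseteq> A"
    have "(norm (sum u E))\<^sup>2 \<le> B * (\<Sum>i\<in>E. (a i)\<^sup>2)"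
      by (rule norm_synthesis_le[where q = q, OF ip_u q[OF E]]) (use E B in auto)
    also have "\<dots> \<le> B * (\<Sum>\<^sub>\<infinity>i\<in>A. (a i)\<^sup>2)"
      using B by (intro mult_left_mono finite_sum_le_infsum[OF a E]) auto
    finally show "(norm (sum u E))\<^sup>2 \<le> B * (\<Sum>\<^sub>\<infinity>i\<in>A. (a i)\<^sup>2)" .
  qed
qed simp


lemma coercive_imp_bounded_below:
  assumes "c * (norm x)\<^sup>2 \<le> norm (ip (S x) x)"
  shows "c * norm x \<le> norm (S x)"
proof (cases "x = 0")
  case False
  have "(c * norm x) * norm x \<le> norm (S x) * norm x"
    using order_trans[OF assms Cauchy_Schwarz] by (simp add: power2_eq_square ac_simps)
  then show ?thesis using False by simp
qed simp

section \<open>Frame operators\<close>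

text \<open>Frames and fusion frames are treated together: \<open>u\<^sub>i\<close> is the rank-one operator \<open>f \<mapsto> \<langle>f, g\<^sub>i\<rangle>g\<^sub>i\<close> with
  \<open>q\<^sub>i(f) = |\<langle>f, g\<^sub>i\<rangle>|\<close> for the former, and \<open>\<omega>\<^sub>i\<^sup>2\<pi>\<^sub>i\<close> with \<open>q\<^sub>i(f) = \<omega>\<^sub>i\<parallel>\<pi>\<^sub>if\<parallel>\<close> for the latter.\<close>

context
  fixes A :: "'i set" and u :: "'i \<Rightarrow> 'a \<Rightarrow> 'a" and q :: "'i \<Rightarrow> 'a \<Rightarrow> real" and B :: real
  assumes u: "\<And>i. i \<in> A \<Longrightarrow> bounded_operator smul (u i)"
    and ip_u: "\<And>i f h. i \<in> A \<Longrightarrow> norm (ip (u i f) h) \<le> q i f * q i h"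
    and ip_u_self: "\<And>i f. i \<in> A \<Longrightarrow> ip (u i f) f = of_real ((q i f)\<^sup>2)"
    and B: "B > 0"
    and q: "\<And>f E. finite E \<Longrightarrow> E \<subseteq> A \<Longrightarrow> (\<Sum>i\<in>E. (q i f)\<^sup>2) \<le> B * (norm f)\<^sup>2"
begin

lemma analysis_summable: "(\<lambda>i. (q i f)\<^sup>2) summable_on A"
  and analysis_infsum_le: "(\<Sum>\<^sub>\<infinity>i\<in>A. (q i f)\<^sup>2) \<le> B * (norm f)\<^sup>2"
  by (rule nonneg_finite_sums_bounded[where C = "B * (norm f)\<^sup>2"], simp, erule (1) q)+

lemma frame_sum_has_sum: "((\<lambda>i. u i f) has_sum (\<Sum>\<^sub>\<infinity>i\<in>A. u i f)) A"
  by (rule has_sum_infsum,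
      rule synthesis_summable[where a = "\<lambda>i. q i f" and q = q, OF ip_u q B analysis_summable])

lemma bounded_operator_frame_sum: "bounded_operator smul (\<lambda>f. \<Sum>\<^sub>\<infinity>i\<in>A. u i f)"
proof (rule bounded_operatorI[where C = B])
  fix f h c
  have "((\<lambda>i. u i f + u i h) has_sum ((\<Sum>\<^sub>\<infinity>i\<in>A. u i f) + (\<Sum>\<^sub>\<infinity>i\<in>A. u i h))) A"
    by (intro has_sum_add frame_sum_has_sum)
  also have "?this \<longleftrightarrow> ((\<lambda>i. u i (f + h)) has_sum ((\<Sum>\<^sub>\<infinity>i\<in>A. u i f) + (\<Sum>\<^sub>\<infinity>i\<in>A. u i h))) A"
    by (intro has_sum_cong) (simp add: bounded_operatorD[OF u])
  finally show "(\<Sum>\<^sub>\<infinity>i\<in>A. u i (f + h)) = (\<Sum>\<^sub>\<infinity>i\<in>A. u i f) + (\<Sum>\<^sub>\<infinity>i\<in>A. u i h)"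
    by (rule infsumI)
  have "((\<lambda>i. smul c (u i f)) has_sum smul c (\<Sum>\<^sub>\<infinity>i\<in>A. u i f)) A"
    by (intro has_sum_bounded_linear[OF bounded_linear_smul_right] frame_sum_has_sum)
  also have "?this \<longleftrightarrow> ((\<lambda>i. u i (smul c f)) has_sum smul c (\<Sum>\<^sub>\<infinity>i\<in>A. u i f)) A"
    by (intro has_sum_cong) (simp add: bounded_operatorD[OF u])
  finally show "(\<Sum>\<^sub>\<infinity>i\<in>A. u i (smul c f)) = smul c (\<Sum>\<^sub>\<infinity>i\<in>A. u i f)"
    by (rule infsumI)
  have "(norm (\<Sum>\<^sub>\<infinity>i\<in>A. u i f))\<^sup>2 \<le> B * (\<Sum>\<^sub>\<infinity>i\<in>A. (q i f)\<^sup>2)"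
    by (rule norm_infsum_synthesis_le[where q = q, OF ip_u q B analysis_summable])
  also have "\<dots> \<le> B * (B * (norm f)\<^sup>2)" using B by (intro mult_left_mono analysis_infsum_le) auto
  also have "\<dots> = (B * norm f)\<^sup>2" by (simp add: power2_eq_square)
  finally show "norm (\<Sum>\<^sub>\<infinity>i\<in>A. u i f) \<le> B * norm f"
    by (rule power2_le_imp_le) (use B in simp)
qed

lemma ip_frame_sum: "ip (\<Sum>\<^sub>\<infinity>i\<in>A. u i f) f = of_real (\<Sum>\<^sub>\<infinity>i\<in>A. (q i f)\<^sup>2)"
proof -
  have "((\<lambda>i. ip (u i f) f) has_sum ip (\<Sum>\<^sub>\<infinity>i\<in>A. u i f) f) A"
    by (rule has_sum_bounded_linear[OF bounded_linear_ip_left frame_sum_has_sum])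
  moreover have "((\<lambda>i. ip (u i f) f) has_sum of_real (\<Sum>\<^sub>\<infinity>i\<in>A. (q i f)\<^sup>2)) A"
    using has_sum_of_real[OF has_sum_infsum[OF analysis_summable], where 'a = 'k]
    by (simp add: ip_u_self cong: has_sum_cong del: of_real_power)
  ultimately show ?thesis by (rule has_sum_unique)
qed

lemma norm_ip_frame_sum: "norm (ip (\<Sum>\<^sub>\<infinity>i\<in>A. u i f) f) = (\<Sum>\<^sub>\<infinity>i\<in>A. (q i f)\<^sup>2)"
  unfolding ip_frame_sum norm_of_real by (simp add: infsum_nonneg)

end

subsection \<open>The frame operator of a fusion frame\<close>

lemma bessel_fusionD:
  assumes "bessel_fusion smul ip I W w" and "i \<in> I"
  shows "closed_subspace smul (W i)" and "w i > 0"
  using assms by (auto simp: bessel_fusion_def)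

lemma bessel_fusion_bound:
  assumes "bessel_fusion smul ip I W w"
  obtains B where "B > 0"
    and "\<And>f E. finite E \<Longrightarrow> E \<subseteq> I \<Longrightarrow> (\<Sum>i\<in>E. (w i * norm (proj (W i) f))\<^sup>2) \<le> B * (norm f)\<^sup>2"
proof -
  obtain B where B: "\<And>f. (\<lambda>i. (w i)\<^sup>2 * (norm (proj (W i) f))\<^sup>2) summable_on I"
      "\<And>f. (\<Sum>\<^sub>\<infinity>i\<in>I. (w i)\<^sup>2 * (norm (proj (W i) f))\<^sup>2) \<le> B * (norm f)\<^sup>2"
    using assms unfolding bessel_fusion_def by blast
  have "(\<Sum>i\<in>E. (w i * norm (proj (W i) f))\<^sup>2) \<le> max B 1 * (norm f)\<^sup>2"
    if E: "finite E" "E \<subseteq> I" for f E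
  proof -
    have "(\<Sum>i\<in>E. (w i * norm (proj (W i) f))\<^sup>2) \<le> B * (norm f)\<^sup>2"
      using order_trans[OF finite_sum_le_infsum[OF B(1) E] B(2)] by (simp add: power_mult_distrib)
    also have "\<dots> \<le> max B 1 * (norm f)\<^sup>2" by (intro mult_right_mono) auto
    finally show ?thesis .
  qed
  then show ?thesis by (intro that[of "max B 1"]) auto
qed

lemma
  assumes W: "bessel_fusion smul ip I W w"
  shows bounded_operator_fusion_operator: "bounded_operator smul (fusion_operator ip I W w)"
    and norm_ip_fusion_operator: "norm (ip (fusion_operator ip I W w f) f)
      = (\<Sum>\<^sub>\<infinity>i\<in>I. (w i)\<^sup>2 * (norm (proj (W i) f))\<^sup>2)"
proof -
  obtain B where B: "B > 0" "\<And>f E. finite E \<Longrightarrow> E \<subseteq> I \<Longrightarrow>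
      (\<Sum>i\<in>E. (w i * norm (proj (W i) f))\<^sup>2) \<le> B * (norm f)\<^sup>2"
    using bessel_fusion_bound[OF W] by blast
  define u where "u i f = (w i)\<^sup>2 *\<^sub>R proj (W i) f" for i f
  define q where "q i f = w i * norm (proj (W i) f)" for i f
  have u: "bounded_operator smul (u i)" if "i \<in> I" for i
    unfolding u_def scaleR_eq_smul
    by (rule bounded_operator_compose[OF _ bounded_operator_proj[OF bessel_fusionD(1)[OF W that]]])
       (rule bounded_operatorI[where C = "norm (of_real ((w i)\<^sup>2) :: 'k)"],
         simp_all add: scale_right_distrib norm_smul scale_left_commute)
  have ip_u: "norm (ip (u i f) h) \<le> q i f * q i h" if "i \<in> I" for i f h
  proof -
    note Wi = bessel_fusionD(1)[OF W that]
    have "ip (u i f) h = of_real ((w i)\<^sup>2) * ip (proj (W i) f) (proj (W i) h)"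
      using ip_proj_right[OF Wi proj_mem[OF Wi]] by (simp add: u_def ip_scaleR_left)
    then have "norm (ip (u i f) h) = (w i)\<^sup>2 * norm (ip (proj (W i) f) (proj (W i) h))"
      by (simp add: norm_mult norm_power)
    also have "\<dots> \<le> (w i)\<^sup>2 * (norm (proj (W i) f) * norm (proj (W i) h))"
      by (intro mult_left_mono Cauchy_Schwarz) auto
    finally show ?thesis by (simp add: q_def power2_eq_square ac_simps)
  qed
  have ip_u_self: "ip (u i f) f = of_real ((q i f)\<^sup>2)" if "i \<in> I" for i f
    using ip_proj_self[OF bessel_fusionD(1)[OF W that]]
    by (simp add: u_def q_def ip_scaleR_left power_mult_distrib)
  have S: "fusion_operator ip I W w = (\<lambda>f. \<Sum>\<^sub>\<infinity>i\<in>I. u i f)"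
    by (simp add: fusion_operator_def u_def fun_eq_iff)
  note facts = u ip_u ip_u_self B(1) B(2)[folded q_def]
  show "bounded_operator smul (fusion_operator ip I W w)"
    unfolding S by (rule bounded_operator_frame_sum[OF facts])
  show "norm (ip (fusion_operator ip I W w f) f)
      = (\<Sum>\<^sub>\<infinity>i\<in>I. (w i)\<^sup>2 * (norm (proj (W i) f))\<^sup>2)"
    unfolding S using norm_ip_frame_sum[OF facts, where f = f] by (simp add: q_def power_mult_distrib)
qed

text \<open>The lower fusion frame bound reads \<open>A\<parallel>K\<^sup>*y\<parallel>\<^sup>2 \<le> \<langle>S\<^sub>Wy, y\<rangle>\<close>, and \<open>K\<^sup>*\<close> is bounded below on \<open>R(K)\<close>; hence
  \<open>S\<^sub>W\<close> is bounded below on \<open>R(K)\<close>. Its inverse on \<open>S\<^sub>W(R(K))\<close> therefore extends to a bounded operator of the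
  whole space, whose adjoint, projected onto \<open>S\<^sub>W(R(K))\<close>, is the adjoint of the inverse.\<close>

lemma bounded_operator_fusion_inv_adjoint:
  assumes K: "bounded_operator smul K" and cl: "closed (range K)"
    and W: "K_fusion_frame smul ip K I W w"
  shows "bounded_operator smul (fusion_inv_adjoint ip K I W w)"
proof -
  define S where "S = fusion_operator ip I W w"
  have bes: "bessel_fusion smul ip I W w" and "\<exists>A>0. \<forall>f. A * (norm (adj K f))\<^sup>2
      \<le> (\<Sum>\<^sub>\<infinity>i\<in>I. (w i)\<^sup>2 * (norm (proj (W i) f))\<^sup>2)"
    using W by (simp_all only: K_fusion_frame_def)
  then obtain A where A: "A > 0" "\<And>f. A * (norm (adj K f))\<^sup>2
      \<le> (\<Sum>\<^sub>\<infinity>i\<in>I. (w i)\<^sup>2 * (norm (proj (W i) f))\<^sup>2)" by blast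
  obtain C where C: "C > 0" "\<And>y. y \<in> range K \<Longrightarrow> norm y \<le> C * norm (adj K y)"
    using adj_bounded_below_on_closed_range[OF K cl] by blast
  have S: "bounded_operator smul S"
    unfolding S_def by (rule bounded_operator_fusion_operator[OF bes])
  note R = closed_subspace_range[OF K cl]
  have below: "\<forall>y\<in>range K. A / C\<^sup>2 * norm y \<le> norm (S y)"
  proof (rule ballI, rule coercive_imp_bounded_below)
    fix y assume y: "y \<in> range K"
    have "(norm y)\<^sup>2 \<le> C\<^sup>2 * (norm (adj K y))\<^sup>2"
      using power_mono[OF C(2)[OF y], of 2] by (simp add: power_mult_distrib)
    then have "A / C\<^sup>2 * (norm y)\<^sup>2 \<le> A / C\<^sup>2 * (C\<^sup>2 * (norm (adj K y))\<^sup>2)"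
      using A(1) by (intro mult_left_mono) auto
    also have "\<dots> = A * (norm (adj K y))\<^sup>2" using C(1) by simp
    also have "\<dots> \<le> norm (ip (S y) y)" unfolding S_def norm_ip_fusion_operator[OF bes] by (rule A(2))
    finally show "A / C\<^sup>2 * (norm y)\<^sup>2 \<le> norm (ip (S y) y)" .
  qed
  have c: "A / C\<^sup>2 > 0" using A(1) C(1) by simp
  note inverse = bounded_operator_bounded_below_inverse[OF S R c below]
    and image = closed_subspace_bounded_below_image[OF S R c below]
  have "fusion_inv_adjoint ip K I W w
      = (\<lambda>y. proj (S ` range K) (adj (bounded_below_inverse S (range K)) y))"
    unfolding fusion_inv_adjoint_def Let_def S_def[symmetric]
    by (rule ext, rule adjoint_on_subspace[OF inverse image],
        rule bounded_below_inverse_eq[OF S R c below, symmetric])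
  then show ?thesis
    using bounded_operator_compose[OF bounded_operator_proj[OF image] bounded_operator_adj[OF inverse]]
    by simp
qed

subsection \<open>Local frames and their canonical duals\<close>

context
  fixes U :: "'a set" and J :: "'j set" and g :: "'j \<Rightarrow> 'a" and A B :: real
  assumes U: "closed_subspace smul U" and frame: "frame_for ip U J g A B"
begin

lemma frame_mem: "j \<in> J \<Longrightarrow> g j \<in> U"
  using frame by (simp add: frame_for_def)

lemma frame_bounds: "0 < A" "0 < B"
proof -
  have "0 < A \<and> A \<le> B" using frame unfolding frame_for_def by (elim conjE) (intro conjI)
  then show "0 < A" "0 < B" by auto
qed

text \<open>The factor \<open>\<parallel>\<pi>\<^sub>Uf\<parallel>\<close> rather than \<open>\<parallel>f\<parallel>\<close> is what lets the bounds of local frames add up to the Bessel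
  bound of the fusion sequence.\<close>

lemma frame_bessel_bound:
  assumes E: "finite E" "E \<subseteq> J"
  shows "(\<Sum>j\<in>E. (norm (ip f (g j)))\<^sup>2) \<le> B * (norm (proj U f))\<^sup>2"
proof -
  have P: "(\<lambda>j. (norm (ip (proj U f) (g j)))\<^sup>2) summable_on J"
      "(\<Sum>\<^sub>\<infinity>j\<in>J. (norm (ip (proj U f) (g j)))\<^sup>2) \<le> B * (norm (proj U f))\<^sup>2"
    using frame proj_mem[OF U, of f] unfolding frame_for_def by blast+
  have "(\<Sum>j\<in>E. (norm (ip f (g j)))\<^sup>2) = (\<Sum>j\<in>E. (norm (ip (proj U f) (g j)))\<^sup>2)"
    using E(2) by (intro sum.cong) (auto simp: ip_proj_left[OF U frame_mem])
  also have "\<dots> \<le> B * (norm (proj U f))\<^sup>2"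
    using order_trans[OF finite_sum_le_infsum[OF P(1) E] P(2)] by simp
  finally show ?thesis .
qed

lemma frame_bessel_bound':
  assumes "finite E" "E \<subseteq> J"
  shows "(\<Sum>j\<in>E. (norm (ip f (g j)))\<^sup>2) \<le> B * (norm f)\<^sup>2"
proof -
  have "B * (norm (proj U f))\<^sup>2 \<le> B * (norm f)\<^sup>2"
    using frame_bounds(2) by (intro mult_left_mono power_mono norm_proj_le[OF U]) auto
  then show ?thesis using frame_bessel_bound[OF assms, of f] by linarith
qed

lemma
  shows bounded_operator_frame_operator: "bounded_operator smul (frame_operator smul ip J g)"
    and frame_operator_has_sum:
      "((\<lambda>j. smul (ip f (g j)) (g j)) has_sum frame_operator smul ip J g f) J"
    and norm_ip_frame_operator:
      "norm (ip (frame_operator smul ip J g f) f) = (\<Sum>\<^sub>\<infinity>j\<in>J. (norm (ip f (g j)))\<^sup>2)"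
proof -
  define u where "u j f = smul (ip f (g j)) (g j)" for j f
  define q where "q j f = norm (ip f (g j))" for j f
  have u: "bounded_operator smul (u j)" if "j \<in> J" for j
  proof (rule bounded_operatorI[where C = "norm (g j) * norm (g j)"])
    show "norm (u j f) \<le> norm (g j) * norm (g j) * norm f" for f
      using mult_right_mono[OF Cauchy_Schwarz[of f "g j"], of "norm (g j)"]
      by (simp add: u_def norm_smul ac_simps)
  qed (simp_all add: u_def ip_add_left ip_scale_left scale_left_distrib)
  have ip_u: "norm (ip (u j f) h) \<le> q j f * q j h" if "j \<in> J" for j f h
    by (simp add: u_def q_def ip_scale_left norm_mult norm_ip_commute[of h])
  have ip_u_self: "ip (u j f) f = of_real ((q j f)\<^sup>2)" if "j \<in> J" for j f
    using mult_scalar_conj_of_real[of "ip f (g j)"] ip_conj_sym[of "g j" f]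
    by (simp add: u_def q_def ip_scale_left)
  have S: "frame_operator smul ip J g = (\<lambda>f. \<Sum>\<^sub>\<infinity>j\<in>J. u j f)"
    by (simp add: frame_operator_def u_def fun_eq_iff)
  note facts = u ip_u ip_u_self frame_bounds(2) frame_bessel_bound'[folded q_def]
  show "bounded_operator smul (frame_operator smul ip J g)"
    unfolding S by (rule bounded_operator_frame_sum[OF facts])
  show "((\<lambda>j. smul (ip f (g j)) (g j)) has_sum frame_operator smul ip J g f) J"
    unfolding S using frame_sum_has_sum[OF facts, where f = f] by (simp add: u_def)
  show "norm (ip (frame_operator smul ip J g f) f) = (\<Sum>\<^sub>\<infinity>j\<in>J. (norm (ip f (g j)))\<^sup>2)"
    unfolding S using norm_ip_frame_sum[OF facts, where f = f] by (simp add: q_def)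
qed

lemma frame_operator_coercive:
  "f \<in> U \<Longrightarrow> A * (norm f)\<^sup>2 \<le> norm (ip (frame_operator smul ip J g f) f)"
  unfolding norm_ip_frame_operator using frame by (simp add: frame_for_def)

lemma frame_operator_bounded_below:
  "\<forall>f\<in>U. A * norm f \<le> norm (frame_operator smul ip J g f)"
  by (rule ballI, rule coercive_imp_bounded_below, rule frame_operator_coercive)

lemma frame_operator_proj: "frame_operator smul ip J g (proj U f) = frame_operator smul ip J g f"
  unfolding frame_operator_def by (rule infsum_cong) (simp add: ip_proj_left[OF U frame_mem])

lemma frame_operator_mem: "frame_operator smul ip J g f \<in> U"
proof -
  note P = bounded_operator_proj[OF U]
  have "((\<lambda>j. proj U (smul (ip f (g j)) (g j))) has_sum proj U (frame_operator smul ip J g f)) J"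
    by (rule has_sum_bounded_linear[OF bounded_operatorD(5)[OF P] frame_operator_has_sum])
  then have "((\<lambda>j. smul (ip f (g j)) (g j)) has_sum proj U (frame_operator smul ip J g f)) J"
    by (simp add: bounded_operatorD(2)[OF P] proj_ident[OF U] frame_mem cong: has_sum_cong)
  then have "proj U (frame_operator smul ip J g f) = frame_operator smul ip J g f"
    using frame_operator_has_sum has_sum_unique by blast
  then show ?thesis using proj_mem[OF U] by metis
qed

abbreviation (input) frame_inverse :: "'a \<Rightarrow> 'a" where
  "frame_inverse \<equiv> bounded_below_inverse (frame_operator smul ip J g) U"

lemmas frame_operator_below = bounded_operator_frame_operator U frame_bounds(1)
  frame_operator_bounded_below

text \<open>A vector of \<open>U\<close> orthogonal to the image would be orthogonal to its own image, which coercivity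
  excludes.\<close>

lemma frame_operator_image: "frame_operator smul ip J g ` U = U"
proof (intro equalityI subsetI)
  fix y assume y: "y \<in> U"
  let ?S = "frame_operator smul ip J g"
  note image = closed_subspace_bounded_below_image[OF frame_operator_below]
  define d where "d = y - proj (?S ` U) y"
  have proj_in: "proj (?S ` U) y \<in> ?S ` U" by (rule proj_mem[OF image])
  then have "proj (?S ` U) y \<in> U" using frame_operator_mem by auto
  then have d: "d \<in> U" using y closed_subspaceD(4)[OF U] by (simp add: d_def)
  have "ip d (?S d) = 0"
    using proj_orthogonal[OF image imageI[OF d], of y] by (simp add: d_def)
  then have "A * (norm d)\<^sup>2 \<le> 0"
    using frame_operator_coercive[OF d] norm_ip_commute[of d "?S d"] by simp
  then have "d = 0" using frame_bounds(1) by (simp add: mult_le_0_iff)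
  then show "y \<in> ?S ` U" using proj_in by (simp add: d_def)
qed (use frame_operator_mem in auto)

lemma canonical_dual_eq: "j \<in> J \<Longrightarrow> canonical_dual smul ip U J g j = frame_inverse (g j)"
  unfolding canonical_dual_def
  by (simp add: bounded_below_inverse_eq[OF frame_operator_below] frame_operator_image frame_mem)

text \<open>The series is obtained from the one defining \<open>Sf = S\<pi>\<^sub>Uf\<close> by applying the bounded inverse of \<open>S\<close> term
  by term.\<close>

lemma canonical_dual_reconstruction:
  "((\<lambda>j. smul (ip f (g j)) (canonical_dual smul ip U J g j)) has_sum proj U f) J"
proof -
  let ?S = "frame_operator smul ip J g"
  note R = bounded_operator_bounded_below_inverse[OF frame_operator_below]
  have sum: "((\<lambda>j. frame_inverse (smul (ip f (g j)) (g j))) has_sum frame_inverse (?S f)) J"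
    by (rule has_sum_bounded_linear[OF bounded_operatorD(5)[OF R] frame_operator_has_sum])
  have total: "frame_inverse (?S f) = proj U f"
    using bounded_below_inverse_left[OF frame_operator_below proj_mem[OF U], of f]
    by (simp add: frame_operator_proj)
  have "frame_inverse (smul (ip f (g j)) (g j))
      = smul (ip f (g j)) (canonical_dual smul ip U J g j)" if "j \<in> J" for j
    using that by (simp add: bounded_operatorD(2)[OF R] canonical_dual_eq)
  from has_sum_cong[OF this] sum[unfolded total] show ?thesis by (rule iffD1)
qed

text \<open>The canonical dual is the image of the frame under the inverse frame operator \<open>R\<close>, so its coefficients
  for \<open>f\<close> are the frame coefficients of \<open>R\<^sup>*f\<close>, and \<open>\<parallel>R\<^sup>*\<parallel> \<le> 1/A\<close>.\<close>

lemma canonical_dual_bessel_bound: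
  assumes "finite E" "E \<subseteq> J"
  shows "(\<Sum>j\<in>E. (norm (ip f (canonical_dual smul ip U J g j)))\<^sup>2) \<le> B * (norm f / A)\<^sup>2"
proof -
  note R = bounded_operator_bounded_below_inverse[OF frame_operator_below]
  have "(\<Sum>j\<in>E. (norm (ip f (canonical_dual smul ip U J g j)))\<^sup>2)
      = (\<Sum>j\<in>E. (norm (ip (adj frame_inverse f) (g j)))\<^sup>2)"
    using assms(2) by (intro sum.cong) (auto simp: canonical_dual_eq ip_adj_left[OF R])
  also have "\<dots> \<le> B * (norm (adj frame_inverse f))\<^sup>2"
    by (rule frame_bessel_bound'[OF assms])
  also have "\<dots> \<le> B * (norm f / A)\<^sup>2"
    using frame_bounds norm_adj_le[OF R norm_bounded_below_inverse_le[OF frame_operator_below], of f]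
    by (intro mult_left_mono power_mono) auto
  finally show ?thesis .
qed

end

section \<open>Duality of fusion frames and of their local frames\<close>

lemma local_frames_uniform_bounds:
  assumes "local_frames ip I V J g A B"
  obtains a b where "a > 0" "b > 0" "\<And>i. i \<in> I \<Longrightarrow> a \<le> A i" "\<And>i. i \<in> I \<Longrightarrow> B i \<le> b"
proof -
  have inf: "0 < (INF i\<in>I. ereal (A i))" and sup: "(SUP i\<in>I. ereal (B i)) < \<infinity>"
    using assms by (simp_all add: local_frames_def)
  obtain a where a: "0 < ereal a" "ereal a < (INF i\<in>I. ereal (A i))"
    using ereal_dense2[OF inf] by blast
  obtain b where b: "(SUP i\<in>I. ereal (B i)) < ereal b"
    using ereal_dense2[OF sup] by blast
  have "a \<le> A i" if "i \<in> I" for i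
  proof -
    have "ereal a < ereal (A i)" using a(2) INF_lower[OF that] by (rule less_le_trans)
    then show ?thesis by simp
  qed
  (* b may be negative if I is empty *)
  moreover have "B i \<le> max b 1" if "i \<in> I" for i
  proof -
    have "ereal (B i) < ereal b" using SUP_upper[OF that] b by (rule le_less_trans)
    then show ?thesis by simp
  qed
  ultimately show ?thesis using a(1) by (intro that[of a "max b 1"]) auto
qed

context
  fixes I :: "'i set" and V :: "'i \<Rightarrow> 'a set" and v :: "'i \<Rightarrow> real" and J :: "'i \<Rightarrow> 'j set"
    and g :: "'i \<Rightarrow> 'j \<Rightarrow> 'a" and A B :: "'i \<Rightarrow> real"
  assumes V: "bessel_fusion smul ip I V v" and local: "local_frames ip I V J g A B"
begin

lemma local_frame: "i \<in> I \<Longrightarrow> frame_for ip (V i) (J i) (g i) (A i) (B i)"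
  using local by (simp add: local_frames_def)

lemma bessel_seq_local_frames: "bessel_seq ip (Sigma I J) (\<lambda>(i, j). v i *\<^sub>R g i j)"
proof -
  obtain a b where b: "b > 0" "\<And>i. i \<in> I \<Longrightarrow> B i \<le> b"
    using local_frames_uniform_bounds[OF local] by metis
  obtain C where C: "C > 0" "\<And>f E. finite E \<Longrightarrow> E \<subseteq> I \<Longrightarrow>
      (\<Sum>i\<in>E. (v i * norm (proj (V i) f))\<^sup>2) \<le> C * (norm f)\<^sup>2"
    using bessel_fusion_bound[OF V] by blast
  define G where "G = (\<lambda>(i, j). v i *\<^sub>R g i j)"
  have fin: "(\<Sum>p\<in>E. (norm (ip f (G p)))\<^sup>2) \<le> (b * C) * (norm f)\<^sup>2"
    if "finite E" "E \<subseteq> Sigma I J" for f E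
  proof (rule finite_Sigma_sum_le[OF _ _ that])
    fix i E assume i: "i \<in> I" and E: "finite E" "E \<subseteq> J i"
    note Vi = bessel_fusionD(1)[OF V i]
    have "(\<Sum>j\<in>E. (norm (ip f (G (i, j))))\<^sup>2) = (v i)\<^sup>2 * (\<Sum>j\<in>E. (norm (ip f (g i j)))\<^sup>2)"
      by (simp add: G_def ip_scaleR_right norm_mult power_mult_distrib sum_distrib_left)
    also have "\<dots> \<le> (v i)\<^sup>2 * (b * (norm (proj (V i) f))\<^sup>2)"
      using order_trans[OF frame_bessel_bound[OF Vi local_frame[OF i] E]
          mult_right_mono[OF b(2)[OF i]]] by (intro mult_left_mono) auto
    finally show "(\<Sum>j\<in>E. (norm (ip f (G (i, j))))\<^sup>2) \<le> b * (v i * norm (proj (V i) f))\<^sup>2"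
      by (simp add: power_mult_distrib ac_simps)
  next
    fix E assume E: "finite E" "E \<subseteq> I"
    have "(\<Sum>i\<in>E. b * (v i * norm (proj (V i) f))\<^sup>2) = b * (\<Sum>i\<in>E. (v i * norm (proj (V i) f))\<^sup>2)"
      by (simp add: sum_distrib_left)
    also have "\<dots> \<le> b * (C * (norm f)\<^sup>2)" using b(1) by (intro mult_left_mono C(2) E) auto
    finally show "(\<Sum>i\<in>E. b * (v i * norm (proj (V i) f))\<^sup>2) \<le> b * C * (norm f)\<^sup>2" by simp
  qed
  show ?thesis
    unfolding bessel_seq_def G_def[symmetric]
  proof (intro exI allI conjI)
    fix f
    show "(\<lambda>p. (norm (ip f (G p)))\<^sup>2) summable_on Sigma I J"
      by (rule nonneg_finite_sums_bounded(1)[OF _ fin]) auto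
    show "(\<Sum>\<^sub>\<infinity>p\<in>Sigma I J. (norm (ip f (G p)))\<^sup>2) \<le> b * C * (norm f)\<^sup>2"
      by (rule nonneg_finite_sums_bounded(2)[OF _ fin]) auto
  qed
qed

context
  fixes W :: "'i \<Rightarrow> 'a set" and w :: "'i \<Rightarrow> real" and R :: "'a set" and L :: "'a \<Rightarrow> 'a"
  assumes W: "bessel_fusion smul ip I W w" and R: "closed_subspace smul R"
    and L: "bounded_operator smul L"
begin

abbreviation (input) local_dual :: "'i \<Rightarrow> 'j \<Rightarrow> 'a" where
  "local_dual i \<equiv> canonical_dual smul ip (V i) (J i) (g i)"

abbreviation (input) transported_dual :: "'i \<times> 'j \<Rightarrow> 'a" where
  "transported_dual \<equiv> (\<lambda>(i, j). w i *\<^sub>R proj R (proj (W i) (L (local_dual i j))))"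

text \<open>Moving all operators to the other side of the inner product, the coefficients of \<open>h\<close> in the
  \<open>i\<close>-th block are \<open>\<omega>\<^sub>i\<close> times those of \<open>L\<^sup>*\<pi>\<^sub>W\<pi>\<^sub>Rh\<close> against the canonical dual in \<open>V\<^sub>i\<close>; the uniform bounds of
  the local frames reduce the sum over all blocks to the Bessel bound of \<open>W\<close> at \<open>\<pi>\<^sub>Rh\<close>.\<close>

lemma transported_dual_bessel_bound:
  obtains D where "D > 0" and "\<And>h E. finite E \<Longrightarrow> E \<subseteq> Sigma I J \<Longrightarrow>
    (\<Sum>p\<in>E. (norm (ip h (transported_dual p)))\<^sup>2) \<le> D * (norm h)\<^sup>2"
proof -
  obtain a b where ab: "a > 0" "b > 0" "\<And>i. i \<in> I \<Longrightarrow> a \<le> A i" "\<And>i. i \<in> I \<Longrightarrow> B i \<le> b"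
    using local_frames_uniform_bounds[OF local] by metis
  obtain C where C: "C > 0" "\<And>f E. finite E \<Longrightarrow> E \<subseteq> I \<Longrightarrow>
      (\<Sum>i\<in>E. (w i * norm (proj (W i) f))\<^sup>2) \<le> C * (norm f)\<^sup>2"
    using bessel_fusion_bound[OF W] by blast
  obtain c where c: "c > 0" "\<And>x. norm (L x) \<le> c * norm x"
    using bounded_operator_bound[OF L] by blast
  define F where "F = transported_dual"
  define k where "k = b * (c / a)\<^sup>2"
  have k: "k > 0" using ab c by (simp add: k_def)
  have fin: "(\<Sum>p\<in>E. (norm (ip h (F p)))\<^sup>2) \<le> (k * C) * (norm h)\<^sup>2"
    if "finite E" "E \<subseteq> Sigma I J" for h E
  proof (rule finite_Sigma_sum_le[OF _ _ that])
    fix i E assume i: "i \<in> I" and E: "finite E" "E \<subseteq> J i"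
    note Vi = bessel_fusionD(1)[OF V i] and Wi = bessel_fusionD(1)[OF W i]
    define z where "z = adj L (proj (W i) (proj R h))"
    have "norm z \<le> c * norm (proj (W i) (proj R h))"
      unfolding z_def by (rule norm_adj_le[OF L c(2)])
    then have "norm z / A i \<le> c * norm (proj (W i) (proj R h)) / a"
      using ab(1) ab(3)[OF i] c(1) by (intro frac_le) auto
    then have z: "(norm z / A i)\<^sup>2 \<le> (c * norm (proj (W i) (proj R h)) / a)\<^sup>2"
      using ab(1) ab(3)[OF i] by (intro power_mono) auto
    have "ip h (F (i, j)) = of_real (w i) * ip z (local_dual i j)" for j
      by (simp add: F_def z_def ip_scaleR_right ip_adj_left[OF L] ip_proj_swap[OF R]
          ip_proj_swap[OF Wi])
    then have "(\<Sum>j\<in>E. (norm (ip h (F (i, j))))\<^sup>2)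
        = (w i)\<^sup>2 * (\<Sum>j\<in>E. (norm (ip z (local_dual i j)))\<^sup>2)"
      by (simp add: norm_mult power_mult_distrib sum_distrib_left)
    also have "\<dots> \<le> (w i)\<^sup>2 * (B i * (norm z / A i)\<^sup>2)"
      by (intro mult_left_mono canonical_dual_bessel_bound[OF Vi local_frame[OF i] E]) auto
    also have "\<dots> \<le> (w i)\<^sup>2 * (b * (c * norm (proj (W i) (proj R h)) / a)\<^sup>2)"
      using ab(2) ab(4)[OF i] by (intro mult_left_mono mult_mono z) auto
    finally show "(\<Sum>j\<in>E. (norm (ip h (F (i, j))))\<^sup>2)
        \<le> k * (w i * norm (proj (W i) (proj R h)))\<^sup>2"
      by (simp add: k_def power_mult_distrib power_divide ac_simps)
  next
    fix E assume E: "finite E" "E \<subseteq> I"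
    have "(\<Sum>i\<in>E. k * (w i * norm (proj (W i) (proj R h)))\<^sup>2)
        = k * (\<Sum>i\<in>E. (w i * norm (proj (W i) (proj R h)))\<^sup>2)"
      by (simp add: sum_distrib_left)
    also have "\<dots> \<le> k * (C * (norm (proj R h))\<^sup>2)" using k by (intro mult_left_mono C(2) E) auto
    also have "\<dots> \<le> k * (C * (norm h)\<^sup>2)"
      using k C(1) norm_proj_le[OF R, of h] by (intro mult_left_mono power_mono) auto
    finally show "(\<Sum>i\<in>E. k * (w i * norm (proj (W i) (proj R h)))\<^sup>2) \<le> k * C * (norm h)\<^sup>2" by simp
  qed
  show ?thesis using k C(1) fin unfolding F_def by (intro that[of "k * C"]) auto
qed

text \<open>Both sequences are Bessel: the coefficients \<open>\<langle>f, \<upsilon>\<^sub>ig\<^sub>i\<^sub>j\<rangle>\<close> are square-summable, and the vectors they multiply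
  satisfy the Bessel bound required for synthesis.\<close>

lemma double_series_summable:
  "(\<lambda>p. smul (ip f ((\<lambda>(i, j). v i *\<^sub>R g i j) p)) (transported_dual p)) summable_on Sigma I J"
proof -
  define G where "G = (\<lambda>(i, j). v i *\<^sub>R g i j)"
  define F where "F = transported_dual"
  obtain D where D: "D > 0" "\<And>h E. finite E \<Longrightarrow> E \<subseteq> Sigma I J \<Longrightarrow>
      (\<Sum>p\<in>E. (norm (ip h (F p)))\<^sup>2) \<le> D * (norm h)\<^sup>2"
    unfolding F_def using transported_dual_bessel_bound by blast
  have G: "(\<lambda>p. (norm (ip f (G p)))\<^sup>2) summable_on Sigma I J"
    using bessel_seq_local_frames unfolding bessel_seq_def G_def by blast
  have "norm (ip (smul (ip f (G p)) (F p)) h) \<le> norm (ip f (G p)) * norm (ip h (F p))" for p h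
    by (simp add: ip_scale_left norm_mult norm_ip_commute[of h])
  then have "(\<lambda>p. smul (ip f (G p)) (F p)) summable_on Sigma I J"
    by (rule synthesis_summable[where q = "\<lambda>p h. norm (ip h (F p))", OF _ D(2) D(1) G])
  then show ?thesis by (simp only: G_def F_def)
qed

text \<open>Reconstruction of \<open>\<pi>\<^sub>if\<close> in \<open>V\<^sub>i\<close> by the canonical dual, transported by the bounded operator
  \<open>\<pi>\<^sub>R\<pi>\<^sub>WL\<close>.\<close>

lemma inner_series_has_sum:
  assumes i: "i \<in> I"
  shows "((\<lambda>j. smul (ip f ((\<lambda>(i, j). v i *\<^sub>R g i j) (i, j))) (transported_dual (i, j)))
    has_sum (w i * v i) *\<^sub>R proj R (proj (W i) (L (proj (V i) f)))) (J i)"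
proof -
  note Vi = bessel_fusionD(1)[OF V i] and Wi = bessel_fusionD(1)[OF W i]
  define T where "T x = proj R (proj (W i) (L x))" for x
  have T: "bounded_operator smul T"
    unfolding T_def
    by (intro bounded_operator_compose[OF bounded_operator_proj[OF R]]
        bounded_operator_compose[OF bounded_operator_proj[OF Wi]] L)
  have "((\<lambda>j. (w i * v i) *\<^sub>R T (smul (ip f (g i j)) (local_dual i j)))
      has_sum (w i * v i) *\<^sub>R T (proj (V i) f)) (J i)"
    by (intro has_sum_scaleR has_sum_bounded_linear[OF bounded_operatorD(5)[OF T]]
        canonical_dual_reconstruction[OF Vi local_frame[OF i]])
  moreover have "(w i * v i) *\<^sub>R T (smul (ip f (g i j)) (local_dual i j))
      = smul (ip f (v i *\<^sub>R g i j)) (w i *\<^sub>R T (local_dual i j))" for j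
    by (simp add: bounded_operatorD(2)[OF T] ip_scale_right scaleR_eq_smul ac_simps)
  ultimately show ?thesis by (simp add: T_def)
qed

text \<open>Since the double series converges unconditionally, it may be summed block by block, and each
  block is the corresponding term of the fusion series.\<close>

lemma double_series_has_sum_iff:
  "((\<lambda>p. smul (ip f ((\<lambda>(i, j). v i *\<^sub>R g i j) p)) (transported_dual p)) has_sum s) (Sigma I J)
    \<longleftrightarrow> ((\<lambda>i. (w i * v i) *\<^sub>R proj R (proj (W i) (L (proj (V i) f)))) has_sum s) I"
  using has_sum_SigmaD[OF _ inner_series_has_sum] 
    has_sum_SigmaI[OF inner_series_has_sum _ double_series_summable] by blast

end

end

end

theorem theorem3p16:
  fixes smul :: "'k::rc_field \<Rightarrow> 'a::banach \<Rightarrow> 'a"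
    and ip :: "'a \<Rightarrow> 'a \<Rightarrow> 'k"
    and K :: "'a \<Rightarrow> 'a"
    and I :: "'i set" and J :: "'i \<Rightarrow> 'j set"
    and W V :: "'i \<Rightarrow> 'a set" and w v :: "'i \<Rightarrow> real"
    and g :: "'i \<Rightarrow> 'j \<Rightarrow> 'a" and A B :: "'i \<Rightarrow> real"
  assumes "hilbert_space smul ip"
    and "separable_space (euclidean :: 'a topology)"
    and "bounded_operator smul K" and "closed (range K)"
    and "countable I" and "\<And>i. i \<in> I \<Longrightarrow> countable (J i)"
    and "K_fusion_frame smul ip K I W w"
    and "bessel_fusion smul ip I V v"
    and "local_frames ip I V J g A B"
  shows "fusion_K_dual smul ip K I V v W w \<longleftrightarrow>
    seq_K_dual smul ip K (Sigma I J)
      (\<lambda>(i, j). v i *\<^sub>R g i j)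
      (\<lambda>(i, j). w i *\<^sub>R orth_proj ip (range K) (orth_proj ip (W i)
         (fusion_inv_adjoint ip K I W w (K (canonical_dual smul ip (V i) (J i) (g i) j)))))"
proof -
  interpret hilbert_space smul ip by fact
  have W: "bessel_fusion smul ip I W w"
    using assms(7) unfolding K_fusion_frame_def by (rule conjunct1)
  note R = closed_subspace_range[OF assms(3,4)]
  have L: "bounded_operator smul (\<lambda>x. fusion_inv_adjoint ip K I W w (K x))"
    by (rule bounded_operator_compose[OF bounded_operator_fusion_inv_adjoint[OF assms(3,4,7)]
          assms(3)])
  show ?thesis
    unfolding fusion_K_dual_def seq_K_dual_def
      double_series_has_sum_iff[OF assms(8,9) W R L]
    using assms(7,8) bessel_seq_local_frames[OF assms(8,9)] by simp
qed

end
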